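(* Let $L\ge1$ and $M\ge3$ be integers, let $(X_n)_{n\ge0}$ be the deterministic walk in an i.i.d. excited random environment on $\mathbb{Z}$ with maximal jump size $L$, with $M$ cookies per site and with cookie distribution $\mu$ (as defined in the context), and for $\lambda\ge 0$ let $$\phi(\lambda)=\lim_{n\to\infty}\frac1n\log\mathbb{P}\left(X_n\geq\lambda n\right)\in[-\infty,0].$$ Let $\alpha,\beta>0$ be real numbers with $\alpha+\beta=1$. Then for any $\lambda_1,\lambda_2>0$ $$\phi(\alpha\lambda_1+\beta\lambda_2)\geq\alpha\phi(\lambda_1)+\beta\phi(\lambda_2).$$ Moreover, $\phi(0)=0$, $\phi(\lambda)<0$ for $\lambda>0$, and $\phi(\lambda)=-\infty$ for $\lambda>L$.
   Context: For integers $a\le b$ write $[a,b]=\{a,a+1,\dots,b\}$. For positive integers $L,M$ the set of environments is $$\Omega=\Omega(L,M)=\left\{\omega\in[-L,L]^{\mathbb{Z}_{\ge0}\times\mathbb{Z}}:\ \omega(j,z)=\omega(M-1,z)\text{ for all } j\ge M-1 \text{ and all } z\in\mathbb{Z}\right\}.$$ The values $\omega(0,z),\dots,\omega(M-1,z)$ are called the cookies at $z$. $\Omega$ is equipped with the probability measure $\mathbb{P}$ under which $\{\omega(j,z): 0\le j\le M-1,\ z\in\mathbb{Z}\}$ are i.i.d. with distribution $\mu$ on $[-L,L]$, where $\mu(k)>0$ for every $k\in[-L,L]$. For $\omega\in\Omega$ the walk $X_t=X_t(\omega)$ is defined recursively by $X_0=0$ and $X_{t+1}=X_t+\omega(L_t(X_t),X_t)$,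 where $L_t(z)=L_t(\omega,z)=|\{0\le j<t: X_j=z\}|$ is the number of visits to $z$ during times $0,\dots,t-1$. For $M\ge3$ the limit defining $\phi(\lambda)$ exists for every $\lambda\ge0$ (it is finite for $\lambda\in[0,L]$). Convention: $\log 0=-\infty$, with the usual arithmetic and order on $[-\infty,0]$. *)

theory Defs
  imports "HOL-Probability.Probability"
begin

section \<open>Environments\<close>

definition envs :: "nat \<Rightarrow> nat \<Rightarrow> (nat \<times> int \<Rightarrow> int) set" where
  "envs L M = {\<omega>. (\<forall>j z. \<omega> (j, z) \<in> {- int L..int L}) \<and>
                  (\<forall>j\<ge>M - 1. \<forall>z. \<omega> (j, z) = \<omega> (M - 1, z))}"

definition env_space :: "nat \<Rightarrow> nat \<Rightarrow> (nat \<times> int \<Rightarrow> int) measure" where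
  "env_space L M = restrict_space (PiM UNIV (\<lambda>_. count_space UNIV)) (envs L M)"

definition cookie_space :: "nat \<Rightarrow> int pmf \<Rightarrow> int measure" where
  "cookie_space L \<mu> = restrict_space (measure_pmf \<mu>) {- int L..int L}"

definition extend_cookies :: "nat \<Rightarrow> (nat \<times> int \<Rightarrow> int) \<Rightarrow> nat \<times> int \<Rightarrow> int" where
  "extend_cookies M c = (\<lambda>(j, z). c (min j (M - 1), z))"

text \<open>
  An environment is determined by its cookies \<open>\<omega> (j, z)\<close> with \<open>j < M\<close>, so the law of the
  environment is the image of the product measure on the cookies.  The cookies take values in
  \<open>{- L..L}\<close>; it is assumed throughout that this is the support of \<open>\<mu>\<close>.  That the result is
  the measure on \<open>envs L M\<close> that makes the cookies i.i.d. with law \<open>\<mu>\<close> is shown in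
  \<open>env_measure_iid\<close> below.
\<close>

definition env_measure :: "nat \<Rightarrow> nat \<Rightarrow> int pmf \<Rightarrow> (nat \<times> int \<Rightarrow> int) measure" where
  "env_measure L M \<mu> =
     distr (PiM ({..<M} \<times> UNIV) (\<lambda>_. cookie_space L \<mu>)) (env_space L M) (extend_cookies M)"


section \<open>The walk\<close>

definition visits :: "(nat \<Rightarrow> int) \<Rightarrow> nat \<Rightarrow> int \<Rightarrow> nat" where
  "visits X t z = card {j. j < t \<and> X j = z}"

lemma visits_cong [fundef_cong]:
  assumes "t = t'" "z = z'" "\<And>j. j < t' \<Longrightarrow> X j = Y j"
  shows "visits X t z = visits Y t' z'"
  using assms by (auto simp: visits_def intro!: arg_cong[of _ _ card])

fun walk :: "(nat \<times> int \<Rightarrow> int) \<Rightarrow> nat \<Rightarrow> int" where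
  "walk \<omega> 0 = 0"
| "walk \<omega> (Suc t) = walk \<omega> t + \<omega> (visits (\<lambda>j. walk \<omega> j) t (walk \<omega> t), walk \<omega> t)"


section \<open>The rate function\<close>

definition log_ereal :: "real \<Rightarrow> ereal" where
  "log_ereal p = (if p = 0 then -\<infinity> else ereal (ln p))"

definition tail_prob :: "nat \<Rightarrow> nat \<Rightarrow> int pmf \<Rightarrow> real \<Rightarrow> nat \<Rightarrow> real" where
  "tail_prob L M \<mu> x n =
     measure (env_measure L M \<mu>) {\<omega> \<in> envs L M. real_of_int (walk \<omega> n) \<ge> x}"

text \<open>
  \<open>lim\<close> is the limit in the extended reals; for \<open>M \<ge> 3\<close> and \<open>v \<ge> 0\<close> it exists.  The event in
  \<open>tail_prob\<close> is measurable by \<open>measurable_walk\<close> below.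
\<close>

definition rate :: "nat \<Rightarrow> nat \<Rightarrow> int pmf \<Rightarrow> real \<Rightarrow> ereal" where
  "rate L M \<mu> v = lim (\<lambda>n. ereal (1 / real n) * log_ereal (tail_prob L M \<mu> (v * real n) n))"


section \<open>Adequacy of the measure\<close>

lemma space_env_space [simp]: "space (env_space L M) = envs L M"
  by (simp add: env_space_def space_restrict_space space_PiM)

lemma space_env_measure [simp]: "space (env_measure L M \<mu>) = envs L M"
  by (simp add: env_measure_def)

lemma sets_env_measure: "sets (env_measure L M \<mu>) = sets (env_space L M)"
  by (simp add: env_measure_def)

lemma space_cookie_space [simp]: "space (cookie_space L \<mu>) = {- int L..int L}"
  by (simp add: cookie_space_def space_restrict_space)

lemma sets_cookie_space: "sets (cookie_space L \<mu>) = Pow {- int L..int L}"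
  by (auto simp: cookie_space_def sets_restrict_space)

lemma prob_space_cookie_space:
  assumes "set_pmf \<mu> = {- int L..int L}"
  shows "prob_space (cookie_space L \<mu>)"
proof
  have "emeasure (measure_pmf \<mu>) (set_pmf \<mu>) = 1"
    by (simp add: measure_pmf.emeasure_eq_measure measure_pmf_zero_iff measure_pmf.prob_eq_1 AE_measure_pmf)
  then show "emeasure (cookie_space L \<mu>) (space (cookie_space L \<mu>)) = 1"
    using assms by (simp add: cookie_space_def emeasure_restrict_space space_restrict_space)
qed

lemma measurable_extend_cookies:
  assumes "M \<ge> 1"
  shows "extend_cookies M \<in>
           PiM ({..<M} \<times> UNIV) (\<lambda>_. cookie_space L \<mu>) \<rightarrow>\<^sub>M env_space L M"
proof -
  let ?P = "PiM ({..<M} \<times> (UNIV :: int set)) (\<lambda>_. cookie_space L \<mu>)"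
  have comp: "(\<lambda>c. c (min j (M - 1), z)) \<in> ?P \<rightarrow>\<^sub>M count_space UNIV" for j z
  proof -
    have "(min j (M - 1), z) \<in> {..<M} \<times> UNIV"
      using assms by auto
    then have "(\<lambda>c. c (min j (M - 1), z)) \<in> ?P \<rightarrow>\<^sub>M cookie_space L \<mu>"
      by (rule measurable_component_singleton)
    moreover have "(\<lambda>x. x) \<in> cookie_space L \<mu> \<rightarrow>\<^sub>M count_space UNIV"
      by (auto simp: measurable_def sets_cookie_space)
    ultimately show ?thesis
      by (rule measurable_compose)
  qed
  have "extend_cookies M \<in> ?P \<rightarrow>\<^sub>M PiM UNIV (\<lambda>_. count_space UNIV)"
    by (rule measurable_PiM_single')
       (use comp in \<open>auto simp: extend_cookies_def split: prod.splits\<close>)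
  moreover have "extend_cookies M c \<in> envs L M" if "c \<in> space ?P" for c
  proof -
    have "c (i, z) \<in> {- int L..int L}" if "i < M" for i z
      using \<open>c \<in> space ?P\<close> that by (auto simp: space_PiM PiE_def Pi_def)
    then show ?thesis
      using assms by (auto simp: envs_def extend_cookies_def)
  qed
  ultimately show ?thesis
    unfolding env_space_def by (intro measurable_restrict_space2) auto
qed

lemma prob_space_env_measure:
  assumes "M \<ge> 1" and "set_pmf \<mu> = {- int L..int L}"
  shows "prob_space (env_measure L M \<mu>)"
proof -
  interpret product_prob_space "\<lambda>_. cookie_space L \<mu>" "{..<M} \<times> (UNIV :: int set)"
    by (intro product_prob_spaceI prob_space_cookie_space assms)
  show ?thesis
    unfolding env_measure_def
    by (intro prob_space_distr measurable_extend_cookies assms)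
qed

lemma measurable_cookie:
  "(\<lambda>\<omega>. \<omega> i) \<in> env_measure L M \<mu> \<rightarrow>\<^sub>M cookie_space L \<mu>"
proof -
  have "(\<lambda>\<omega>. \<omega> i) \<in> env_space L M \<rightarrow>\<^sub>M count_space UNIV"
    unfolding env_space_def
    by (intro measurable_restrict_space1 measurable_component_singleton) auto
  then have "(\<lambda>\<omega>. \<omega> i) \<in> env_space L M \<rightarrow>\<^sub>M restrict_space (count_space UNIV) {- int L..int L}"
    by (intro measurable_restrict_space2) (cases i, auto simp: envs_def)
  then show ?thesis
    by (subst measurable_cong_sets[OF sets_env_measure, of "cookie_space L \<mu>"
          "restrict_space (count_space UNIV) {- int L..int L}"])
       (auto simp: sets_cookie_space sets_restrict_space)
qed

lemma env_measure_iid: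
  assumes M: "M \<ge> 1" and \<mu>: "set_pmf \<mu> = {- int L..int L}"
  shows "prob_space.indep_vars (env_measure L M \<mu>) (\<lambda>_. cookie_space L \<mu>) (\<lambda>i \<omega>. \<omega> i)
           ({..<M} \<times> UNIV)"
    and "i \<in> {..<M} \<times> UNIV \<Longrightarrow>
           distr (env_measure L M \<mu>) (cookie_space L \<mu>) (\<lambda>\<omega>. \<omega> i) = cookie_space L \<mu>"
proof -
  let ?I = "{..<M} \<times> (UNIV :: int set)"
  let ?C = "\<lambda>_ :: nat \<times> int. cookie_space L \<mu>"
  interpret E: prob_space "env_measure L M \<mu>"
    by (rule prob_space_env_measure[OF M \<mu>])
  interpret C: product_prob_space ?C ?I
    by (intro product_prob_spaceI prob_space_cookie_space \<mu>)
  have marg: "distr (env_measure L M \<mu>) (cookie_space L \<mu>) (\<lambda>\<omega>. \<omega> i) = cookie_space L \<mu>"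
    if i: "i \<in> ?I" for i
  proof -
    have "distr (env_measure L M \<mu>) (cookie_space L \<mu>) (\<lambda>\<omega>. \<omega> i) =
          distr (PiM ?I ?C) (cookie_space L \<mu>) ((\<lambda>\<omega>. \<omega> i) \<circ> extend_cookies M)"
      unfolding env_measure_def
      by (intro distr_distr measurable_extend_cookies M)
         (use measurable_cookie[of i L M \<mu>] in
           \<open>simp add: measurable_cong_sets[OF sets_env_measure refl]\<close>)
    also have "(\<lambda>\<omega>. \<omega> i) \<circ> extend_cookies M = (\<lambda>c. c i)"
      using i by (cases i) (auto simp: extend_cookies_def fun_eq_iff min_def)
    also have "distr (PiM ?I ?C) (cookie_space L \<mu>) (\<lambda>c. c i) = cookie_space L \<mu>"
      using C.PiM_component[OF i] .
    finally show ?thesis .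
  qed
  then show "i \<in> ?I \<Longrightarrow>
      distr (env_measure L M \<mu>) (cookie_space L \<mu>) (\<lambda>\<omega>. \<omega> i) = cookie_space L \<mu>" .
  have rI: "(\<lambda>\<omega>. \<lambda>i\<in>?I. \<omega> i) \<in> env_measure L M \<mu> \<rightarrow>\<^sub>M PiM ?I ?C"
    by (intro measurable_restrict measurable_cookie)
  have "distr (env_measure L M \<mu>) (PiM ?I ?C) (\<lambda>\<omega>. \<lambda>i\<in>?I. \<omega> i) =
        distr (PiM ?I ?C) (PiM ?I ?C) ((\<lambda>\<omega>. \<lambda>i\<in>?I. \<omega> i) \<circ> extend_cookies M)"
    unfolding env_measure_def
    by (intro distr_distr measurable_extend_cookies M)
       (use rI in \<open>simp add: measurable_cong_sets[OF sets_env_measure refl]\<close>)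
  also have "\<dots> = distr (PiM ?I ?C) (PiM ?I ?C) (\<lambda>c. c)"
  proof (rule distr_cong)
    fix c assume "c \<in> space (PiM ?I ?C)"
    then show "((\<lambda>\<omega>. \<lambda>i\<in>?I. \<omega> i) \<circ> extend_cookies M) c = c"
      by (auto simp: space_PiM PiE_def extensional_def extend_cookies_def fun_eq_iff min_def
          restrict_def)
  qed simp_all
  also have "\<dots> = PiM ?I ?C"
    by simp
  also have "\<dots> = PiM ?I (\<lambda>i. distr (env_measure L M \<mu>) (?C i) (\<lambda>\<omega>. \<omega> i))"
    by (intro PiM_cong refl marg[symmetric])
  finally show "E.indep_vars ?C (\<lambda>i \<omega>. \<omega> i) ?I"
    using M by (subst E.indep_vars_iff_distr_eq_PiM')
               (auto intro: measurable_cookie simp: lessThan_empty_iff)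
qed

lemma measurable_count_space_combine:
  fixes f :: "'a \<Rightarrow> 'b::countable" and g :: "'a \<Rightarrow> 'c::countable"
  assumes f: "f \<in> E \<rightarrow>\<^sub>M count_space UNIV" and g: "g \<in> E \<rightarrow>\<^sub>M count_space UNIV"
  shows "(\<lambda>x. h (f x) (g x)) \<in> E \<rightarrow>\<^sub>M count_space UNIV"
proof (rule measurable_compose_countable[OF _ f])
  fix a show "(\<lambda>x. h a (g x)) \<in> E \<rightarrow>\<^sub>M count_space UNIV"
    by (rule measurable_compose[OF g]) simp
qed

lemma measurable_walk:
  "(\<lambda>\<omega>. walk \<omega> n) \<in> env_measure L M \<mu> \<rightarrow>\<^sub>M count_space UNIV"
proof (induction n rule: less_induct)
  case (less n)
  let ?E = "env_measure L M \<mu>"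
  have cookie: "(\<lambda>\<omega>. \<omega> i) \<in> ?E \<rightarrow>\<^sub>M count_space UNIV" for i
    by (rule measurable_compose[OF measurable_cookie])
       (auto simp: measurable_def sets_cookie_space)
  show ?case
  proof (cases n)
    case (Suc t)
    have w: "(\<lambda>\<omega>. walk \<omega> j) \<in> ?E \<rightarrow>\<^sub>M count_space UNIV" if "j \<le> t" for j
      using less Suc that by simp
    have *: "(\<lambda>\<omega>. visits (walk \<omega>) k (walk \<omega> t)) \<in> ?E \<rightarrow>\<^sub>M count_space UNIV" if "k \<le> t" for k
      using that
    proof (induction k)
      case (Suc k)
      have "visits X (Suc k) z = visits X k z + (if X k = z then 1 else 0)" for X z
      proof -
        have "{j. j < Suc k \<and> X j = z} =
              (if X k = z then insert k {j. j < k \<and> X j = z} else {j. j < k \<and> X j = z})"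
          by (auto simp: less_Suc_eq)
        then show ?thesis
          by (simp add: visits_def)
      qed
      moreover have "(\<lambda>\<omega>. if walk \<omega> k = walk \<omega> t then 1 else 0 :: nat) \<in> ?E \<rightarrow>\<^sub>M count_space UNIV"
        using Suc.prems
        by (intro measurable_count_space_combine[where h = "\<lambda>a b. if a = b then 1 else 0"] w) auto
      ultimately show ?case
        using Suc by (simp add: measurable_count_space_combine[where h = "(+)"])
    qed (simp add: visits_def)
    have "(\<lambda>\<omega>. (visits (walk \<omega>) t (walk \<omega> t), walk \<omega> t)) \<in> ?E \<rightarrow>\<^sub>M count_space UNIV"
      by (rule measurable_count_space_combine[where h = Pair, OF *[OF order_refl] w[OF order_refl]])
    then have "(\<lambda>\<omega>. \<omega> (visits (walk \<omega>) t (walk \<omega> t), walk \<omega> t)) \<in> ?E \<rightarrow>\<^sub>M count_space UNIV"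
      by (rule measurable_compose_countable[OF cookie])
    then have "(\<lambda>\<omega>. walk \<omega> t + \<omega> (visits (walk \<omega>) t (walk \<omega> t), walk \<omega> t))
        \<in> ?E \<rightarrow>\<^sub>M count_space UNIV"
      by (rule measurable_count_space_combine[where h = "(+)", OF w[OF order_refl]])
    then show ?thesis
      using Suc by simp
  qed simp
qed

end

theory Submission
  imports Defs
begin

text \<open>
  Two probabilities are compared: \<open>hit_prob n x\<close>, that the walk reaches \<open>[x, \<infinity>)\<close> within \<open>n\<close>
  steps, and \<open>climb_prob n x\<close>, that it does so without ever stepping below its starting point.

  The event \<open>X\<^sub>n \<ge> x\<close> has the probability \<open>hit_prob n x\<close> up to a constant factor: the site at which
  \<open>[x, \<infinity>)\<close> is entered is new, so with a fixed positive probability all its cookies are \<open>0\<close> and the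
  walk stays there forever (\<open>freeze\<close>).  Since such a trap may wait in each stretch of length \<open>L\<close>,
  \<open>hit_prob\<close> decays exponentially in \<open>x\<close>, which makes the rate negative at positive speeds; and a
  trap at \<open>0\<close> shows that the rate at speed \<open>0\<close> vanishes.

  Climbs can be concatenated: when \<open>[x, \<infinity>)\<close> is entered, at a site \<open>z\<close>, nothing to the right of \<open>z\<close>
  has been used, and a climb that starts from \<open>z\<close> never looks to the left.  Hence \<open>climb_prob\<close> is
  supermultiplicative (\<open>climb_prob_supermult\<close>), and Fekete's lemma provides an exponential rate
  \<open>climb_rate v\<close> for climbing at speed \<open>v\<close>, which is concave in \<open>v\<close>.

  The main point is that hitting has the same exponential rate as climbing, although the part of the
  environment to the left of the start can steer the walk on each of its returns.
  Fix a small \<open>\<eta> > 0\<close>.  Among the \<open>\<lfloor>\<eta> n\<rfloor>\<close> adjacent strips of length \<open>L\<close> to the right of \<open>0\<close>, one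
  is visited at most \<open>K\<close> times during \<open>n\<close> steps, where \<open>K\<close> depends only on \<open>\<eta>\<close>.  All that the
  excursions of the walk beyond the level \<open>y\<close> at the end of this strip can see of the environment below
  \<open>y\<close> is a list of at most \<open>K\<close> pairs of a site of exit and a site of re-entry.
  Such a list can be reproduced by an environment on \<open>(K + 2) L\<close> sites below \<open>y\<close> into which the walk
  is sent from the left end and which it never leaves to the left (\<open>reflection\<close>).  Installing this
  gadget costs a constant factor and a constant delay.  The distance of at most \<open>\<eta> L n\<close> given up is
  regained by moving at full speed for \<open>O(\<eta> n)\<close> steps, which costs a factor \<open>exp (- O(\<eta> n))\<close>
  (\<open>log_hit_upper\<close>).  Finally \<open>\<eta>\<close> tends to \<open>0\<close>.
\<close>

section \<open>The walk from an arbitrary starting point\<close>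

type_synonym env = "nat \<times> int \<Rightarrow> int"

text \<open>
  The state carries the number of past visits to each site, so that the walk becomes a plain
  recursion; \<open>walk_eq_pos\<close> links it to the walk that counts its visits.
\<close>

primrec state :: "env \<Rightarrow> int \<Rightarrow> nat \<Rightarrow> int \<times> (int \<Rightarrow> nat)" where
  "state \<omega> s 0 = (s, \<lambda>_. 0)"
| "state \<omega> s (Suc t) =
     (let (p, c) = state \<omega> s t in (p + \<omega> (c p, p), c(p := Suc (c p))))"

definition pos :: "env \<Rightarrow> int \<Rightarrow> nat \<Rightarrow> int" where
  "pos \<omega> s t = fst (state \<omega> s t)"

definition cnt :: "env \<Rightarrow> int \<Rightarrow> nat \<Rightarrow> int \<Rightarrow> nat" where
  "cnt \<omega> s t = snd (state \<omega> s t)"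

lemma pos_0 [simp]: "pos \<omega> s 0 = s"
  and cnt_0 [simp]: "cnt \<omega> s 0 = (\<lambda>_. 0)"
  and pos_Suc: "pos \<omega> s (Suc t) = pos \<omega> s t + \<omega> (cnt \<omega> s t (pos \<omega> s t), pos \<omega> s t)"
  and cnt_Suc: "cnt \<omega> s (Suc t) = (cnt \<omega> s t)(pos \<omega> s t := Suc (cnt \<omega> s t (pos \<omega> s t)))"
  by (auto simp: pos_def cnt_def split: prod.splits)

lemma cnt_eq_visits: "cnt \<omega> s t z = visits (pos \<omega> s) t z"
proof (induction t)
  case (Suc t)
  have "{j. j < Suc t \<and> pos \<omega> s j = z} =
        (if pos \<omega> s t = z then insert t {j. j < t \<and> pos \<omega> s j = z} else {j. j < t \<and> pos \<omega> s j = z})"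
    by (auto simp: less_Suc_eq)
  with Suc show ?case
    by (auto simp: visits_def cnt_Suc)
qed (simp add: visits_def)

lemma walk_eq_pos: "walk \<omega> t = pos \<omega> 0 t"
proof (induction t rule: less_induct)
  case (less t)
  show ?case
  proof (cases t)
    case (Suc n)
    have "visits (walk \<omega>) n z = cnt \<omega> 0 n z" for z
      unfolding cnt_eq_visits by (rule visits_cong) (use less Suc in auto)
    with less Suc show ?thesis
      by (simp add: pos_Suc)
  qed simp
qed

definition shift_env :: "int \<Rightarrow> env \<Rightarrow> env" where
  "shift_env s \<omega> = (\<lambda>(j, z). \<omega> (j, z + s))"

lemma pos_shift: "pos \<omega> s t = s + pos (shift_env s \<omega>) 0 t"
proof -
  have "pos \<omega> s t = s + pos (shift_env s \<omega>) 0 t \<and>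
        (\<forall>z. cnt \<omega> s t (z + s) = cnt (shift_env s \<omega>) 0 t z)"
  proof (induction t)
    case (Suc t)
    have "cnt \<omega> s t (s + z) = cnt (shift_env s \<omega>) 0 t z" for z
      using Suc by (metis add.commute)
    moreover have "\<omega> (k, s + z) = shift_env s \<omega> (k, z)" for k z
      by (simp add: shift_env_def add.commute)
    ultimately show ?case
      using Suc by (auto simp: pos_Suc cnt_Suc)
  qed simp
  then show ?thesis ..
qed

lemma pos_agree:
  assumes "\<And>j k. j < t \<Longrightarrow> \<omega>' (k, pos \<omega> s j) = \<omega> (k, pos \<omega> s j)" and "i \<le> t"
  shows "pos \<omega>' s i = pos \<omega> s i"
proof -
  have "pos \<omega>' s i = pos \<omega> s i \<and> cnt \<omega>' s i = cnt \<omega> s i"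
    using assms(2) by (induction i) (use assms(1) in \<open>auto simp: pos_Suc cnt_Suc\<close>)
  then show ?thesis ..
qed

lemma cnt_unvisited:
  "(\<And>j. j < t \<Longrightarrow> pos \<omega> s j \<noteq> z) \<Longrightarrow> cnt \<omega> s t z = 0"
  by (induction t) (auto simp: cnt_Suc)

lemma cnt_mono: "t \<le> t' \<Longrightarrow> cnt \<omega> s t z \<le> cnt \<omega> s t' z"
  by (induction t' rule: dec_induct) (auto simp: cnt_Suc)

lemma cnt_eq_if_avoided:
  assumes "t \<le> t'" "\<And>j. t \<le> j \<Longrightarrow> j < t' \<Longrightarrow> pos \<omega> s j \<noteq> z"
  shows "cnt \<omega> s t' z = cnt \<omega> s t z"
  using assms by (induction t' rule: dec_induct) (auto simp: cnt_Suc)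

text \<open>
  At a first visit to a new maximum \<open>z\<close> the sites from \<open>z\<close> on are unused, so as long as the walk
  stays there it moves like a walk started at \<open>z\<close> in the same environment.
\<close>

lemma pos_restart:
  assumes "pos \<omega> s t = z" and "\<And>j. j < t \<Longrightarrow> pos \<omega> s j < z"
    and "\<And>j. j < i \<Longrightarrow> z \<le> pos \<omega> z j"
  shows "pos \<omega> s (t + i) = pos \<omega> z i"
proof -
  have "cnt \<omega> s t w = 0" if "w \<ge> z" for w
    by (rule cnt_unvisited) (use assms(2) that in force)
  then have "pos \<omega> s (t + i) = pos \<omega> z i \<and> (\<forall>w\<ge>z. cnt \<omega> s (t + i) w = cnt \<omega> z i w)"
    using assms(3)
  proof (induction i)
    case (Suc i)
    then show ?case
      by (simp add: pos_Suc cnt_Suc)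
  qed (use assms(1) in auto)
  then show ?thesis ..
qed

lemma envs_range: "\<omega> \<in> envs L M \<Longrightarrow> \<bar>\<omega> (j, z)\<bar> \<le> int L"
  and envs_tail: "\<omega> \<in> envs L M \<Longrightarrow> j \<ge> M - 1 \<Longrightarrow> \<omega> (j, z) = \<omega> (M - 1, z)"
proof -
  assume "\<omega> \<in> envs L M"
  then have "\<omega> (j, z) \<in> {- int L..int L}" by (simp add: envs_def)
  then show "\<bar>\<omega> (j, z)\<bar> \<le> int L" by auto
qed (unfold envs_def, blast)

lemma shift_env_in_envs: "\<omega> \<in> envs L M \<Longrightarrow> shift_env s \<omega> \<in> envs L M"
  unfolding envs_def shift_env_def mem_Collect_eq prod.case by blast

lemma pos_step: "\<omega> \<in> envs L M \<Longrightarrow> \<bar>pos \<omega> s (Suc t) - pos \<omega> s t\<bar> \<le> int L"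
  by (simp add: pos_Suc envs_range)

lemma pos_bound: "\<omega> \<in> envs L M \<Longrightarrow> \<bar>pos \<omega> s t - s\<bar> \<le> int L * int t"
proof (induction t)
  case (Suc t)
  have "\<bar>pos \<omega> s (Suc t) - pos \<omega> s t\<bar> \<le> int L"
    using Suc.prems by (rule pos_step)
  with Suc show ?case by (simp add: algebra_simps)
qed simp

section \<open>Trails\<close>

text \<open>
  A trail is a path that is not yet driven by an environment: it only records, for each site, the list
  of the jumps with which it left this site.  Paths can thus be designed first and turned into
  an environment afterwards; \<open>trail_pos\<close> says that an environment which agrees with the recorded jumps
  makes the walk follow the trail.
\<close>

inductive trail :: "int \<Rightarrow> int \<Rightarrow> nat \<Rightarrow> int \<Rightarrow> (int \<Rightarrow> int list) \<Rightarrow> bool" for L s where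
  start: "trail L s 0 s (\<lambda>_. [])"
| step: "trail L s t p D \<Longrightarrow> \<bar>d\<bar> \<le> L \<Longrightarrow> trail L s (Suc t) (p + d) (D(p := D p @ [d]))"

lemma trail_pos:
  assumes "trail L s t p D" and "\<And>z k. k < length (D z) \<Longrightarrow> \<omega> (k, z) = D z ! k"
  shows "pos \<omega> s t = p" "\<And>z. cnt \<omega> s t z = length (D z)" "\<And>j. j < t \<Longrightarrow> D (pos \<omega> s j) \<noteq> []"
proof -
  have "pos \<omega> s t = p \<and> (\<forall>z. cnt \<omega> s t z = length (D z)) \<and> (\<forall>j<t. D (pos \<omega> s j) \<noteq> [])"
    using assms
  proof induction
    case (step t p D d)
    have 1: "\<omega> (k, z) = D z ! k" if "k < length (D z)" for z k
      using step.prems[of k z] that by (cases "z = p") (auto simp: nth_append)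
    have 2: "\<omega> (length (D p), p) = d"
      using step.prems[of "length (D p)" p] by simp
    show ?case
      using step.IH[OF 1] 2 by (auto simp: pos_Suc cnt_Suc less_Suc_eq)
  qed simp
  then show "pos \<omega> s t = p" "\<And>z. cnt \<omega> s t z = length (D z)" "\<And>j. j < t \<Longrightarrow> D (pos \<omega> s j) \<noteq> []"
    by auto
qed

lemma trail_jumps: "trail L s t p D \<Longrightarrow> d \<in> set (D z) \<Longrightarrow> \<bar>d\<bar> \<le> L"
  by (induction rule: trail.induct) (auto split: if_splits)

definition push :: "int set \<Rightarrow> int \<Rightarrow> (int \<Rightarrow> int list) \<Rightarrow> int \<Rightarrow> int list" where
  "push A d D = (\<lambda>z. if z \<in> A then D z @ [d] else D z)"

lemma trail_lane:
  assumes "trail L s t z D" and "\<bar>d\<bar> \<le> L" and "d \<noteq> 0"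
  shows "trail L s (t + j) (z + int j * d) (push {z + int i * d |i. i < j} d D)"
proof (induction j)
  case 0
  then show ?case using assms by (simp add: push_def)
next
  case (Suc j)
  have "z + int j * d \<notin> {z + int i * d |i. i < j}"
    using assms(3) by auto
  then have "(push {z + int i * d |i. i < j} d D)
      (z + int j * d := push {z + int i * d |i. i < j} d D (z + int j * d) @ [d]) =
      push {z + int i * d |i. i < Suc j} d D"
    by (auto simp: push_def fun_eq_iff less_Suc_eq)
  with trail.step[OF Suc assms(2)] show ?case
    by (simp add: algebra_simps)
qed

section \<open>Replaying the excursions above a level\<close>

text \<open>
  Fix an environment \<open>\<omega>\<close> and a level \<open>y\<close>; the strip consists of the \<open>L\<close> sites below \<open>y\<close>.  Whenever the
  walk leaves \<open>[y, \<infinity>)\<close> it lands at a site \<open>u\<close> of the strip, and it returns by a jump from a site \<open>p\<close> of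
  the strip.  A trail is built that starts far to the left and performs the same excursions
  above \<open>y\<close>, such that below \<open>y\<close> each site has the same jump at all its departures from the \<open>M\<close>-th on.

  While \<open>u\<close> has been used fewer than \<open>M - 1\<close> times its jump is free and can lead directly to \<open>p\<close>.
  Later, the final jump of \<open>u\<close> in \<open>\<omega>\<close> matters.  If it crosses \<open>y\<close>, then \<open>u = p\<close> and the trail
  makes the same jump.  Otherwise \<open>u\<close> gives its control away to a machine.  Let \<open>l\<close> be the first site at
  which this happens.  From then on the jump of \<open>l\<close> is \<open>- L\<close>, and other such sites jump to \<open>l\<close>.  The
  sites \<open>l - j L\<close> form a descending lane, and the sites \<open>c - j L\<close> with \<open>c \<noteq> l\<close> in the strip form
  ascending lanes, in which all jumps are \<open>L\<close>.  When the descending trail meets the site \<open>l - j L\<close> for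
  the first time, it jumps sideways to \<open>p - j L\<close>, in the lane that leads up to \<open>p\<close>; at all
  later times it goes on downwards.  So the \<open>j\<close>-th use of the machine turns at row \<open>j\<close>, and its
  destination \<open>p\<close> can be chosen at will.  The destination is never \<open>l\<close>, because the final jump
  of \<open>l\<close> in \<open>\<omega>\<close> does not cross \<open>y\<close>.

  The trail arrives from the left through the lane of the first \<open>p\<close>, which may be the
  lane of \<open>l\<close>.  Then the jumps of \<open>l - j L\<close> are \<open>L\<close>, one sideways jump, and \<open>- L\<close> forever; this is where
  three cookies per site are needed.
\<close>

context
  fixes \<omega> :: env and L M :: nat and y :: int
  assumes env: "\<omega> \<in> envs L M" and L: "L \<ge> 1" and M: "M \<ge> 3"
begin

abbreviation strip :: "int set" where "strip \<equiv> {y - int L..<y}"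
abbreviation final_jump :: "int \<Rightarrow> int" where "final_jump s \<equiv> \<omega> (M - 1, s)"

text \<open>
  The function \<open>C\<close> gives the visit counts of the walk in \<open>\<omega>\<close>, and \<open>D\<close> the departures of the trail.  The
  condition on the strip says that a site which the trail has used at least \<open>M - 1\<close> times has also been
  used that often by the walk, so that the walk makes its final jump there.
\<close>

definition faithful :: "(int \<Rightarrow> nat) \<Rightarrow> (int \<Rightarrow> int list) \<Rightarrow> bool" where
  "faithful C D \<longleftrightarrow> (\<forall>z\<ge>y. D z = map (\<lambda>k. \<omega> (k, z)) [0..<C z]) \<and>
              (\<forall>s\<in>strip. min (length (D s)) (M - 1) \<le> C s)"

text \<open>
  Below the strip there is only the lane through which the trail arrived.
\<close>

definition machine_off :: "(int \<Rightarrow> int list) \<Rightarrow> bool" where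
  "machine_off D \<longleftrightarrow>
     (\<forall>s\<in>strip. if y \<le> s + final_jump s
        then \<forall>k\<ge>M - 1. k < length (D s) \<longrightarrow> D s ! k = final_jump s
        else length (D s) < M) \<and>
     (\<forall>z<y - int L. length (D z) \<le> 1 \<and> set (D z) \<subseteq> {int L})"

text \<open>
  The machine has been used \<open>R\<close> times, so that the descending lane of \<open>l\<close> is untouched below row \<open>R\<close>
  except possibly for the arrival of the trail.  Together with the sideways jump this accounts for the
  first two departures, which is why only the later ones are required to be \<open>- L\<close>.
\<close>

definition machine_on :: "int \<Rightarrow> nat \<Rightarrow> (int \<Rightarrow> int list) \<Rightarrow> bool" where
  "machine_on l R D \<longleftrightarrow> l \<in> strip \<and> l + final_jump l < y \<and> M - 1 \<le> length (D l) \<and>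
     (\<forall>s\<in>strip. \<forall>k\<ge>M - 1. k < length (D s) \<longrightarrow>
        D s ! k = (if y \<le> s + final_jump s then final_jump s else if s = l then - int L else l - s)) \<and>
     (\<forall>z<y - int L. if int L dvd l - z
        then (\<forall>k\<ge>2. k < length (D z) \<longrightarrow> D z ! k = - int L) \<and>
             (z < l - int R * int L \<longrightarrow> length (D z) \<le> 1)
        else set (D z) \<subseteq> {int L})"

definition simulates :: "(int \<Rightarrow> nat) \<Rightarrow> nat \<Rightarrow> (int \<Rightarrow> int list) \<Rightarrow> bool" where
  "simulates C R D \<longleftrightarrow> faithful C D \<and> (machine_off D \<and> R = 0 \<or> (\<exists>l. machine_on l R D))"

lemma env_tail: "M - 1 \<le> k \<Longrightarrow> \<omega> (k, z) = final_jump z"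
  using envs_tail[OF env] .

text \<open>
  This is the condition under which the departures of the trail can be read as cookies of an
  environment with \<open>M\<close> cookies per site.
\<close>

lemma simulates_settled:
  assumes "simulates C R D" and "M - 1 \<le> k" "k < length (D z)"
  shows "D z ! k = D z ! (M - 1)"
proof -
  consider "z \<ge> y" | "z \<in> strip" | "z < y - int L" by force
  then show ?thesis
  proof cases
    case 1
    with assms have D: "D z = map (\<lambda>k. \<omega> (k, z)) [0..<C z]"
      by (simp add: simulates_def faithful_def)
    from assms(2,3) show ?thesis
      unfolding D by (simp add: env_tail[OF assms(2)])
  next
    case 2
    from assms(1) consider "machine_off D" | l where "machine_on l R D"
      by (auto simp: simulates_def)
    then show ?thesis
    proof cases
      case 1
      with 2 assms(2,3) show ?thesis
        unfolding machine_off_def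
        by (cases "y \<le> z + final_jump z") (auto dest!: bspec[of _ _ z])
    next
      case (2 l)
      have "D z ! k' = (if y \<le> z + final_jump z then final_jump z else if z = l then - int L else l - z)"
        if "M - 1 \<le> k'" "k' < length (D z)" for k'
        using 2 \<open>z \<in> strip\<close> that unfolding machine_on_def by blast
      from this[of k] this[of "M - 1"] assms(2,3) show ?thesis
        by simp
    qed
  next
    case 3
    from assms(1) consider "machine_off D" | l where "machine_on l R D"
      by (auto simp: simulates_def)
    then show ?thesis
    proof cases
      case 1
      with 3 have "length (D z) \<le> 1" by (simp add: machine_off_def)
      with assms M show ?thesis by simp
    next
      case (2 l)
      show ?thesis
      proof (cases "int L dvd l - z")
        case True
        with 2 3 have "\<And>k. k \<ge> 2 \<Longrightarrow> k < length (D z) \<Longrightarrow> D z ! k = - int L"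
          by (simp add: machine_on_def)
        from this[of k] this[of "M - 1"] assms M show ?thesis by simp
      next
        case False
        with 2 3 have "set (D z) \<subseteq> {int L}"
          by (simp add: machine_on_def)
        moreover have "D z ! k \<in> set (D z)" "D z ! (M - 1) \<in> set (D z)"
          using assms by auto
        ultimately have "D z ! k = int L" "D z ! (M - 1) = int L" by blast+
        then show ?thesis by simp
      qed
    qed
  qed
qed

lemma machine_off_cong:
  assumes "\<And>z. z < y \<Longrightarrow> D' z = D z"
  shows "machine_off D' \<longleftrightarrow> machine_off D"
  unfolding machine_off_def using assms by (intro arg_cong2[where f = "(\<and>)"] ball_cong all_cong refl) auto

lemma machine_on_cong:
  assumes "\<And>z. z < y \<Longrightarrow> D' z = D z"
  shows "machine_on l R D' \<longleftrightarrow> machine_on l R D"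
proof (cases "l \<in> strip")
  case True
  then have "D' l = D l" by (intro assms) simp
  then show ?thesis
    unfolding machine_on_def using assms by (intro arg_cong2[where f = "(\<and>)"] ball_cong all_cong refl) auto
qed (unfold machine_on_def, blast)

lemma snoc_const:
  assumes "\<forall>k\<ge>a. k < length xs \<longrightarrow> xs ! k = v" and "a \<le> length xs \<Longrightarrow> d = v"
  shows "\<forall>k\<ge>a. k < length (xs @ [d]) \<longrightarrow> (xs @ [d]) ! k = v"
  using assms by (auto simp: nth_append less_Suc_eq)

lemma machine_off_use:
  assumes D: "machine_off D" and p: "p \<in> strip"
    and d: "M - 1 \<le> length (D p) \<Longrightarrow> y \<le> p + final_jump p \<and> d = final_jump p"
  shows "machine_off (D(p := D p @ [d]))"
proof -
  let ?P = "\<lambda>s ds. if y \<le> s + final_jump s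
        then \<forall>k\<ge>M - 1. k < length ds \<longrightarrow> ds ! k = final_jump s
        else length ds < M"
  have "?P p (D p)"
    using D p unfolding machine_off_def by blast
  then have "?P p (D p @ [d])"
  proof (cases "y \<le> p + final_jump p")
    case True
    with \<open>?P p (D p)\<close> d show ?thesis
      using snoc_const[of "M - 1" "D p" "final_jump p" d] by simp
  next
    case False
    with d have "\<not> M - 1 \<le> length (D p)" by blast
    with False show ?thesis by simp
  qed
  then have 1: "?P s ((D(p := D p @ [d])) s)" if "s \<in> strip" for s
  proof (cases "s = p")
    case False
    with D that show ?thesis unfolding machine_off_def fun_upd_def by simp
  qed (simp only: fun_upd_same)
  have 2: "(D(p := D p @ [d])) z = D z" if "z < y - int L" for z
    using p that by auto
  show ?thesis
    unfolding machine_off_def using 1 2 D by (metis (no_types, lifting) machine_off_def)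
qed

lemma machine_on_use:
  assumes D: "machine_on l R D" and p: "p \<in> strip"
    and d: "M - 1 \<le> length (D p) \<Longrightarrow>
      d = (if y \<le> p + final_jump p then final_jump p else if p = l then - int L else l - p)"
  shows "machine_on l R (D(p := D p @ [d]))"
proof -
  let ?P = "\<lambda>s ds. \<forall>k\<ge>M - 1. k < length ds \<longrightarrow>
        ds ! k = (if y \<le> s + final_jump s then final_jump s else if s = l then - int L else l - s)"
  have "?P p (D p)"
    using D p unfolding machine_on_def by blast
  then have 1: "?P p (D p @ [d])"
    using d by (rule snoc_const)
  have 2: "\<forall>s\<in>strip. ?P s ((D(p := D p @ [d])) s)"
  proof
    fix s assume "s \<in> strip"
    show "?P s ((D(p := D p @ [d])) s)"
    proof (cases "s = p")
      case False
      with D \<open>s \<in> strip\<close> show ?thesis unfolding machine_on_def fun_upd_def by simp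
    next
      case True
      then show ?thesis using 1 by (simp only: fun_upd_same)
    qed
  qed
  have 3: "(D(p := D p @ [d])) z = D z" if "z < y - int L" for z
    using p that by auto
  show ?thesis
    using D 2 3 unfolding machine_on_def by auto
qed

lemma simulates_above:
  assumes "simulates C R D" and "p \<ge> y"
  shows "simulates (C(p := Suc (C p))) R (D(p := D p @ [\<omega> (C p, p)]))"
proof -
  have "faithful (C(p := Suc (C p))) (D(p := D p @ [\<omega> (C p, p)]))"
    using assms by (auto simp: simulates_def faithful_def)
  moreover have "machine_off (D(p := D p @ [\<omega> (C p, p)])) \<longleftrightarrow> machine_off D"
    "machine_on l R (D(p := D p @ [\<omega> (C p, p)])) \<longleftrightarrow> machine_on l R D" for l
    by (rule machine_off_cong machine_on_cong; use assms(2) in auto)+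
  ultimately show ?thesis
    using assms(1) unfolding simulates_def by blast
qed

lemma faithful_settled:
  assumes "faithful C D" "s \<in> strip" "M - 1 \<le> length (D s)"
  shows "M - 1 \<le> C s"
proof -
  have "min (length (D s)) (M - 1) \<le> C s"
    using assms(1,2) unfolding faithful_def by blast
  with assms(3) show ?thesis by simp
qed

lemma faithful_mono:
  assumes "faithful C D" and "\<And>z. z \<ge> y \<Longrightarrow> C' z = C z" and "\<And>s. s \<in> strip \<Longrightarrow> C s \<le> C' s"
  shows "faithful C' D"
  using assms unfolding faithful_def by (metis le_trans)

lemma faithful_use:
  assumes "faithful C D" and "\<And>z. z \<ge> y \<Longrightarrow> C' z = C z" and "\<And>s. s \<in> strip \<Longrightarrow> C s \<le> C' s"
    and "p < y" and "C p < C' p \<or> M - 1 \<le> C' p \<or> p < y - int L"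
  shows "faithful C' (D(p := D p @ [d]))"
proof -
  have "min (Suc (length (D p))) (M - 1) \<le> C' p" if "p \<in> strip"
  proof -
    have "min (length (D p)) (M - 1) \<le> C p"
      using assms(1) that by (simp add: faithful_def)
    with assms(5) that show ?thesis by auto
  qed
  with faithful_mono[OF assms(1-3)] \<open>p < y\<close> show ?thesis
    by (auto simp: faithful_def)
qed

text \<open>
  The return jump above \<open>y\<close> is copied from the walk.  If the trail has used \<open>p\<close> at least \<open>M - 1\<close> times,
  then so has the walk, hence the jump is the final jump of \<open>p\<close> and crosses \<open>y\<close>, as prescribed
  for such sites.
\<close>

lemma simulates_land:
  assumes simulates: "simulates C R D" and p: "p \<in> strip" and cross: "y \<le> p + \<omega> (C p, p)"
  shows "simulates (C(p := Suc (C p))) R (D(p := D p @ [\<omega> (C p, p)]))"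
proof -
  let ?d = "\<omega> (C p, p)"
  have tail: "?d = final_jump p" if "M - 1 \<le> length (D p)"
  proof -
    have "min (length (D p)) (M - 1) \<le> C p"
      using simulates p by (simp add: simulates_def faithful_def)
    with that show ?thesis by (intro env_tail) simp
  qed
  have b: "faithful (C(p := Suc (C p))) (D(p := D p @ [?d]))"
    using simulates p by (intro faithful_use[of C]) (auto simp: simulates_def)
  have "machine_off (D(p := D p @ [?d]))" if "machine_off D"
    by (rule machine_off_use[OF that p]) (use tail cross in simp)
  moreover have "machine_on l R (D(p := D p @ [?d]))" if "machine_on l R D" for l
    by (rule machine_on_use[OF that p]) (use tail cross in simp)
  ultimately show ?thesis
    using simulates b unfolding simulates_def by blast
qed

lemma simulates_hop:
  assumes simulates: "simulates C R D" and u: "u \<in> strip" and few: "length (D u) < M - 1"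
    and C: "\<And>z. z \<ge> y \<Longrightarrow> C' z = C z" "\<And>s. s \<in> strip \<Longrightarrow> C s \<le> C' s" "C u < C' u"
  shows "simulates C' R (D(u := D u @ [d]))"
proof -
  have "faithful C' (D(u := D u @ [d]))"
    using simulates u C by (intro faithful_use[of C]) (auto simp: simulates_def)
  moreover have "machine_off (D(u := D u @ [d]))" if "machine_off D"
    by (rule machine_off_use[OF that u]) (use few in simp)
  moreover have "machine_on l R (D(u := D u @ [d]))" if "machine_on l R D" for l
    by (rule machine_on_use[OF that u]) (use few in simp)
  ultimately show ?thesis
    using simulates unfolding simulates_def by blast
qed

lemma simulates_mono:
  assumes "simulates C R D" and "\<And>z. z \<ge> y \<Longrightarrow> C' z = C z" and "\<And>s. s \<in> strip \<Longrightarrow> C s \<le> C' s"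
  shows "simulates C' R D"
  using assms(1) faithful_mono[of C D C'] assms(2,3) unfolding simulates_def by blast

text \<open>
  Switching on the machine requires no change of the trail: sites whose final jump fails to cross \<open>y\<close>
  have had only their first \<open>M - 1\<close> departures, which are unrestricted.
\<close>

lemma machine_on_start:
  assumes D: "machine_off D" and u: "u \<in> strip" "u + final_jump u < y" "M - 1 \<le> length (D u)"
  shows "machine_on u 0 D"
proof -
  have 1: "D s ! k = (if y \<le> s + final_jump s then final_jump s else if s = u then - int L else u - s)"
    if "s \<in> strip" "M - 1 \<le> k" "k < length (D s)" for s k
  proof -
    have "if y \<le> s + final_jump s
        then \<forall>k\<ge>M - 1. k < length (D s) \<longrightarrow> D s ! k = final_jump s
        else length (D s) < M"
      using D that unfolding machine_off_def by blast
    with that show ?thesis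
      by (cases "y \<le> s + final_jump s") (auto simp: le_diff_conv)
  qed
  have 2: "length (D z) \<le> 1" "set (D z) \<subseteq> {int L}" if "z < y - int L" for z
    using D that unfolding machine_off_def by blast+
  show ?thesis
    unfolding machine_on_def using u 1 2 by fastforce
qed

text \<open>
  One use of the machine: from \<open>l\<close> down to the row \<open>Suc R\<close>, which the descending lane has not reached
  before, sideways to the lane of \<open>p\<close>, and up to \<open>p\<close>.
\<close>

lemma machine_on_run:
  assumes tr: "trail (int L) s0 t l D" and D: "machine_on l R D" and p: "p \<in> strip" "p \<noteq> l"
  obtains D' where "trail (int L) s0 (t + 2 * R + 3) p D'" "machine_on l (Suc R) D'"
    "\<And>z. z \<ge> y \<Longrightarrow> D' z = D z" "\<And>s. s \<in> strip \<Longrightarrow> s \<noteq> l \<Longrightarrow> D' s = D s"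
    "\<And>z. D' z \<noteq> [] \<Longrightarrow> D z \<noteq> [] \<or> y - int L - int (Suc R) * int L \<le> z"
proof -
  define A1 where "A1 = {l + int i * (- int L) |i. i < Suc R}"
  define q where "q = l - int (Suc R) * int L"
  define A2 where "A2 = {p - int (Suc R) * int L + int i * int L |i. i < Suc R}"
  define D1 where "D1 = push A1 (- int L) D"
  define D2 where "D2 = D1(q := D1 q @ [p - l])"
  define D3 where "D3 = push A2 (int L) D2"
  have l: "l \<in> strip" "l + final_jump l < y" "M - 1 \<le> length (D l)"
    and strip: "\<forall>s\<in>strip. \<forall>k\<ge>M - 1. k < length (D s) \<longrightarrow>
        D s ! k = (if y \<le> s + final_jump s then final_jump s else if s = l then - int L else l - s)"
    and lane: "\<And>z. z < y - int L \<Longrightarrow> if int L dvd l - z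
        then (\<forall>k\<ge>2. k < length (D z) \<longrightarrow> D z ! k = - int L) \<and>
             (z < l - int R * int L \<longrightarrow> length (D z) \<le> 1)
        else set (D z) \<subseteq> {int L}"
    using D unfolding machine_on_def by blast+
  have "trail (int L) s0 (t + Suc R) (l + int (Suc R) * (- int L)) D1"
    unfolding D1_def A1_def by (rule trail_lane[OF tr]) (use L in auto)
  then have "trail (int L) s0 (t + Suc R) q D1"
    by (simp add: q_def)
  then have "trail (int L) s0 (Suc (t + Suc R)) (q + (p - l)) D2"
    unfolding D2_def by (rule trail.step) (use p l in auto)
  then have "trail (int L) s0 (Suc (t + Suc R)) (p - int (Suc R) * int L) D2"
    by (simp add: q_def algebra_simps)
  then have "trail (int L) s0 (Suc (t + Suc R) + Suc R) (p - int (Suc R) * int L + int (Suc R) * int L) D3"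
    unfolding D3_def A2_def by (rule trail_lane) (use L in auto)
  then have tr3: "trail (int L) s0 (t + 2 * R + 3) p D3"
    by (simp add: numeral_eq_Suc algebra_simps)
  have SR: "int (Suc R) * int L = int R * int L + int L" "0 \<le> int R * int L"
    by (auto simp: algebra_simps)
  have A1: "int L dvd l - z \<and> l - int R * int L \<le> z \<and> (z = l \<or> z < y - int L)" if "z \<in> A1" for z
  proof -
    from that obtain i where i: "i < Suc R" "z = l - int i * int L"
      by (auto simp: A1_def)
    have "int i * int L \<le> int R * int L"
      using i by (intro mult_right_mono) auto
    then have "l - int R * int L \<le> z"
      unfolding i(2) by linarith
    moreover have "z = l \<or> z < y - int L"
    proof (cases "i = 0")
      case False
      then have "1 * int L \<le> int i * int L"
        by (intro mult_right_mono) auto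
      moreover have "l < y" using l(1) by simp
      ultimately show ?thesis unfolding i(2) by linarith
    qed (simp add: i(2))
    moreover have "int L dvd l - z"
      using i(2) by simp
    ultimately show ?thesis by blast
  qed
  have A2: "int L dvd p - z \<and> z < y - int L \<and> p - int (Suc R) * int L \<le> z" if "z \<in> A2" for z
  proof -
    from that obtain i where i: "i < Suc R" "z = p - int (Suc R) * int L + int i * int L"
      by (auto simp: A2_def)
    then have z: "z = p - (int (Suc R) - int i) * int L"
      by (simp add: algebra_simps)
    have "1 * int L \<le> (int (Suc R) - int i) * int L"
      using i by (intro mult_right_mono) auto
    moreover have "p < y" using p by simp
    ultimately have "z < y - int L"
      unfolding z by linarith
    moreover have "0 \<le> int i * int L" by simp
    then have "p - int (Suc R) * int L \<le> z"
      unfolding i(2) by linarith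
    moreover have "int L dvd p - z"
      by (simp add: z)
    ultimately show ?thesis by blast
  qed
  have q: "int L dvd l - q" "q < y - int L"
  proof -
    show "q < y - int L"
      using l(1) SR unfolding q_def atLeastLessThan_iff by linarith
  qed (simp add: q_def)
  (* Two sites of the strip differ by less than L, so distinct lanes are disjoint. *)
  have lp: "\<not> int L dvd l - z" if "int L dvd p - z" for z
  proof
    assume "int L dvd l - z"
    with that have "int L dvd (p - z) - (l - z)"
      by (rule dvd_diff)
    then have "int L dvd p - l" by simp
    then have "int L \<le> \<bar>p - l\<bar>"
      using p(2) by (metis abs_of_nat dvd_imp_le_int right_minus_eq)
    then show False using p l by auto
  qed
  have lA1: "l \<in> A1"
    by (auto simp: A1_def intro!: exI[of _ 0])
  have nq: "q \<notin> A1" "q \<notin> A2"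
  proof -
    have "\<not> l - int R * int L \<le> q"
      using L SR(1) unfolding q_def by linarith
    then show "q \<notin> A1" using A1 by blast
    show "q \<notin> A2" using A2 lp q(1) by blast
  qed
  have at_l: "D3 l = D l @ [- int L]"
    using lA1 A2[of l] l q unfolding D3_def D2_def D1_def push_def by auto
  have other: "D3 s = D s" if "s \<ge> y - int L" "s \<noteq> l" for s
    using that A1[of s] A2[of s] q unfolding D3_def D2_def D1_def push_def by auto
  have low: "D z \<noteq> [] \<or> y - int L - int (Suc R) * int L \<le> z" if "D3 z \<noteq> []" for z
  proof (rule disjCI)
    assume z: "\<not> y - int L - int (Suc R) * int L \<le> z"
    have "z \<notin> A1" "z \<notin> A2" "z \<noteq> q"
    proof -
      have "y - int L \<le> l" "y - int L \<le> p" using l(1) p(1) by auto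
      then have "\<not> l - int R * int L \<le> z" "\<not> p - int (Suc R) * int L \<le> z" "z \<noteq> q"
        using z L SR unfolding q_def by linarith+
      then show "z \<notin> A1" "z \<notin> A2" "z \<noteq> q"
        using A1 A2 by blast+
    qed
    with that show "D z \<noteq> []"
      unfolding D3_def D2_def D1_def push_def by auto
  qed
  have strip': "\<forall>k\<ge>M - 1. k < length (D3 s) \<longrightarrow>
      D3 s ! k = (if y \<le> s + final_jump s then final_jump s else if s = l then - int L else l - s)"
    if "s \<in> strip" for s
  proof (cases "s = l")
    case True
    show ?thesis
      unfolding True at_l by (rule snoc_const) (use strip l in auto)
  next
    case False
    with other[of s] strip that show ?thesis by auto
  qed
  have lane': "if int L dvd l - z
        then (\<forall>k\<ge>2. k < length (D3 z) \<longrightarrow> D3 z ! k = - int L) \<and>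
             (z < l - int (Suc R) * int L \<longrightarrow> length (D3 z) \<le> 1)
        else set (D3 z) \<subseteq> {int L}" if z: "z < y - int L" for z
  proof (cases "int L dvd l - z")
    case False
    then have "z \<notin> A1" "z \<noteq> q"
      using A1[of z] q by auto
    then have "set (D3 z) \<subseteq> set (D z) \<union> {int L}"
      unfolding D3_def D2_def D1_def push_def by auto
    with lane[OF z] False show ?thesis by auto
  next
    case True
    then have nA2: "z \<notin> A2"
      using A2[of z] lp[of z] by auto
    have old: "\<forall>k\<ge>2. k < length (D z) \<longrightarrow> D z ! k = - int L"
      "z < l - int R * int L \<longrightarrow> length (D z) \<le> 1"
      using lane[OF z] True by auto
    consider "z \<in> A1" | "z = q" | "z \<notin> A1" "z \<noteq> q" by blast
    then show ?thesis
    proof cases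
      case 1
      then have D3: "D3 z = D z @ [- int L]"
        using nA2 nq unfolding D3_def D2_def D1_def push_def by auto
      have "\<forall>k\<ge>2. k < length (D3 z) \<longrightarrow> D3 z ! k = - int L"
        unfolding D3 by (rule snoc_const[OF old(1)]) simp
      moreover have "\<not> z < l - int (Suc R) * int L"
        using A1[OF 1] SR L by linarith
      ultimately show ?thesis using True by simp
    next
      case 2
      then have D3: "D3 z = D z @ [p - l]"
        using nA2 nq unfolding D3_def D2_def D1_def push_def by auto
      have "length (D z) \<le> 1"
        using old(2) 2 L SR(1) unfolding q_def by linarith
      moreover have "\<not> z < l - int (Suc R) * int L"
        unfolding 2 q_def by simp
      ultimately show ?thesis
        using True unfolding D3 by auto
    next
      case 3
      then have D3: "D3 z = D z"
        using nA2 unfolding D3_def D2_def D1_def push_def by auto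
      have "z < l - int R * int L" if "z < l - int (Suc R) * int L"
        using that SR(1) by linarith
      with old True show ?thesis
        unfolding D3 by simp
    qed
  qed
  have "machine_on l (Suc R) D3"
    unfolding machine_on_def
  proof (intro conjI ballI)
    show "M - 1 \<le> length (D3 l)"
      using l(3) unfolding at_l by simp
  qed (use l(1,2) strip' lane' in blast)+
  with tr3 show thesis
    using other low l by (intro that[of D3]) auto
qed

text \<open>
  One stay of the walk below \<open>y\<close>, which lands at \<open>u\<close> and returns from \<open>p\<close>.  The counts \<open>C\<close> are those
  at the landing and \<open>C1\<close> those before the return.  If \<open>u \<noteq> p\<close>, the walk has left \<open>u\<close> in the meantime
  by a jump that did not cross \<open>y\<close>; this pays for the one additional use of \<open>u\<close> by the trail, and shows
  that \<open>u\<close> may use the machine once its number of departures has reached \<open>M - 1\<close>.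
\<close>

lemma simulates_cross:
  assumes tr: "trail (int L) s0 t u D" and simulates: "simulates C R D"
    and u: "u \<in> strip" and p: "p \<in> strip"
    and C1: "\<And>z. z \<ge> y \<Longrightarrow> C1 z = C z" "\<And>s. s \<in> strip \<Longrightarrow> C s \<le> C1 s"
    and dive: "u \<noteq> p \<Longrightarrow> C u < C1 u" "u \<noteq> p \<Longrightarrow> u + \<omega> (C u, u) < y"
    and cross: "y \<le> p + \<omega> (C1 p, p)"
  obtains t' R' D' where "trail (int L) s0 t' (p + \<omega> (C1 p, p)) D'"
    "simulates (C1(p := Suc (C1 p))) R' D'" "t' \<le> t + 2 * R + 5" "R' \<le> Suc R"
    "\<And>z. D' z \<noteq> [] \<Longrightarrow> D z \<noteq> [] \<or> y - int L - int (Suc R) * int L \<le> z"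
proof -
  let ?d = "\<omega> (C1 p, p)"
  note result = that
  have finish: thesis
    if "trail (int L) s0 t1 p D1" "simulates C1 R1 D1" "t1 \<le> t + 2 * R + 4" "R1 \<le> Suc R"
      and low: "\<And>z. D1 z \<noteq> [] \<Longrightarrow> D z \<noteq> [] \<or> y - int L - int (Suc R) * int L \<le> z" for t1 D1 R1
  proof (rule result)
    show "trail (int L) s0 (Suc t1) (p + ?d) (D1(p := D1 p @ [?d]))"
      by (rule trail.step[OF that(1) envs_range[OF env]])
    show "simulates (C1(p := Suc (C1 p))) R1 (D1(p := D1 p @ [?d]))"
      by (rule simulates_land[OF that(2) p cross])
    have "0 \<le> int (Suc R) * int L" "y - int L \<le> p"
      using p by auto
    then have p_range: "y - int L - int (Suc R) * int L \<le> p" by linarith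
    show "D z \<noteq> [] \<or> y - int L - int (Suc R) * int L \<le> z"
      if "(D1(p := D1 p @ [?d])) z \<noteq> []" for z
    proof (cases "z = p")
      case False
      with that show ?thesis by (intro low) simp
    qed (use p_range in simp)
  qed (use that in auto)
  have u_range: "y - int L - int (Suc R) * int L \<le> u"
  proof -
    have "0 \<le> int (Suc R) * int L" "y - int L \<le> u"
      using u by auto
    then show ?thesis by linarith
  qed
  consider "u = p" | "u \<noteq> p" "length (D u) < M - 1" | "u \<noteq> p" "M - 1 \<le> length (D u)"
    by force
  then show thesis
  proof cases
    case 1
    with tr simulates_mono[OF simulates C1] show thesis
      by (intro finish[of t D R]) auto
  next
    case 2
    let ?D = "D(u := D u @ [p - u])"
    have "trail (int L) s0 (Suc t) (u + (p - u)) ?D"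
      by (rule trail.step[OF tr]) (use u p in auto)
    moreover have "simulates C1 R ?D"
      by (rule simulates_hop[OF simulates u 2(2) C1 dive(1)[OF 2(1)]])
    ultimately show thesis
      using u_range by (intro finish[of "Suc t" ?D R]) (auto split: if_splits)
  next
    case 3
    have Cu: "M - 1 \<le> C u"
      using 3 simulates u faithful_settled[of C D u] by (auto simp: simulates_def)
    then have left: "u + final_jump u < y"
      using dive(2)[OF 3(1)] env_tail[OF Cu] by simp
    obtain l R1 where l: "machine_on l R1 D" "R1 \<le> R"
      using simulates machine_on_start[of D u, OF _ u left 3(2)] unfolding simulates_def by blast
    have l_strip: "l \<in> strip" and l_left: "l + final_jump l < y" and l_len: "M - 1 \<le> length (D l)"
      using l(1) unfolding machine_on_def by blast+
    have bD: "faithful C D"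
      using simulates by (simp add: simulates_def)
    have Cl: "M - 1 \<le> C l"
      by (rule faithful_settled[OF bD l_strip l_len])
    then have C1l: "M - 1 \<le> C1 l"
      using C1(2)[OF l_strip] by simp
    (* Both the walk and the trail have left l at least M - 1 times, so the walk can no longer
       cross y from there. *)
    have pl: "p \<noteq> l"
      using cross l_left env_tail[OF C1l] by auto
    obtain t2 D2 where D2: "trail (int L) s0 t2 l D2" "machine_on l R1 D2" "t2 \<le> Suc t"
      "faithful C1 D2" "\<And>z. D2 z \<noteq> [] \<Longrightarrow> D z \<noteq> [] \<or> z = u"
    proof (cases "u = l")
      case True
      with tr l(1) faithful_mono[OF bD C1] show thesis
        by (intro that[of t D]) auto
    next
      case False
      let ?D = "D(u := D u @ [l - u])"
      have "trail (int L) s0 (Suc t) (u + (l - u)) ?D"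
        by (rule trail.step[OF tr]) (use u l_strip in auto)
      moreover have "machine_on l R1 ?D"
        by (rule machine_on_use[OF l(1) u]) (use left False in auto)
      moreover have "faithful C1 ?D"
        by (rule faithful_use[OF bD C1]) (use u dive(1)[OF 3(1)] in auto)
      ultimately show thesis
        by (intro that[of "Suc t" ?D]) (auto split: if_splits)
    qed
    obtain D3 where D3: "trail (int L) s0 (t2 + 2 * R1 + 3) p D3" "machine_on l (Suc R1) D3"
      "\<And>z. z \<ge> y \<Longrightarrow> D3 z = D2 z" "\<And>s. s \<in> strip \<Longrightarrow> s \<noteq> l \<Longrightarrow> D3 s = D2 s"
      "\<And>z. D3 z \<noteq> [] \<Longrightarrow> D2 z \<noteq> [] \<or> y - int L - int (Suc R1) * int L \<le> z"
      using machine_on_run[OF D2(1,2) p pl] by metis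
    have "faithful C1 D3"
      unfolding faithful_def
    proof (intro conjI allI ballI impI)
      fix z assume "z \<ge> y"
      then show "D3 z = map (\<lambda>k. \<omega> (k, z)) [0..<C1 z]"
        using D3(3) D2(4) by (simp add: faithful_def)
    next
      fix s assume s: "s \<in> strip"
      show "min (length (D3 s)) (M - 1) \<le> C1 s"
      proof (cases "s = l")
        case False
        with D3(4) D2(4) s show ?thesis by (simp add: faithful_def)
      qed (use C1l in simp)
    qed
    then have "simulates C1 (Suc R1) D3"
      using D3(2) by (auto simp: simulates_def)
    moreover have "int (Suc R1) * int L \<le> int (Suc R) * int L"
      using l(2) by (intro mult_right_mono) auto
    ultimately show thesis
      using D3(1,5) D2(3,5) l(2) u_range
      by (intro finish[of "t2 + 2 * R1 + 3" D3 "Suc R1"]) (auto simp del: of_nat_Suc, fastforce simp del: of_nat_Suc)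
  qed
qed

end

section \<open>Reflection at a rarely visited strip\<close>

definition strip_visits :: "env \<Rightarrow> nat \<Rightarrow> int \<Rightarrow> nat \<Rightarrow> nat" where
  "strip_visits \<omega> L y t = (\<Sum>s\<in>{y - int L..<y}. cnt \<omega> 0 t s)"

lemma strip_visits_mono: "t \<le> t' \<Longrightarrow> strip_visits \<omega> L y t \<le> strip_visits \<omega> L y t'"
  unfolding strip_visits_def by (intro sum_mono cnt_mono)

lemma strip_visits_Suc:
  assumes "pos \<omega> 0 t \<in> {y - int L..<y}"
  shows "strip_visits \<omega> L y (Suc t) = Suc (strip_visits \<omega> L y t)"
  using assms unfolding strip_visits_def cnt_Suc
  by (simp add: sum.remove[of "{y - int L..<y}" "pos \<omega> 0 t"] del: atLeastLessThan_iff)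

text \<open>
  Each stay below \<open>y\<close> visits the strip, so the number of visits to the strip bounds the number of uses
  of the machine and hence the depth of the gadget, and it also bounds the delay.
  Induction over the times at which the walk is above \<open>y\<close> jumps over the stays below \<open>y\<close>.
\<close>

lemma simulation:
  assumes env: "\<omega> \<in> envs L M" and L: "L \<ge> 1" and M: "M \<ge> 3" and "0 < y"
    and "y \<le> pos \<omega> 0 t" and "strip_visits \<omega> L y t \<le> K"
  shows "\<exists>s t' R D. trail (int L) s t' (pos \<omega> 0 t) D \<and> simulates \<omega> L M y (cnt \<omega> 0 t) R D \<and>
           R \<le> strip_visits \<omega> L y t \<and> t' \<le> t + (2 * K + 5) * strip_visits \<omega> L y t + Suc K \<and>
           (\<forall>z. D z \<noteq> [] \<longrightarrow> s \<le> z) \<and>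
           y - int L - int (Suc K) * int L \<le> s \<and> s < y - int (Suc K) * int L"
  using assms(5,6)
proof (induction t rule: less_induct)
  case (less t)
  let ?V = "strip_visits \<omega> L y" and ?X = "pos \<omega> 0" and ?C = "cnt \<omega> 0"
  let ?S = "{y - int L..<y}"
  obtain n where n: "t = Suc n"
    using less.prems(1) \<open>0 < y\<close> by (cases t) auto
  define p where "p = ?X n"
  define d where "d = \<omega> (?C n p, p)"
  have Xt: "?X t = p + d" and Ct: "?C t = (?C n)(p := Suc (?C n p))"
    by (simp_all add: n pos_Suc cnt_Suc p_def d_def)
  have d: "\<bar>d\<bar> \<le> int L"
    unfolding d_def by (rule envs_range[OF env])
  have above: "\<exists>D'. trail (int L) s (Suc t') (?X (Suc m)) D' \<and> simulates \<omega> L M y (?C (Suc m)) R D' \<and>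
      (\<forall>z. D' z \<noteq> [] \<longrightarrow> s \<le> z)"
    if "y \<le> ?X m" "trail (int L) s t' (?X m) D" "simulates \<omega> L M y (?C m) R D"
      "\<forall>z. D z \<noteq> [] \<longrightarrow> s \<le> z" "s < y" for m s t' R D
    unfolding pos_Suc cnt_Suc
    using trail.step[OF that(2) envs_range[OF env]] simulates_above[OF env L M that(3,1)] that(1,4,5)
    by (intro exI conjI) (assumption, assumption, auto)
  have below_y: "s < y" if "s < y - int (Suc K) * int L" for s
  proof -
    have "0 \<le> int (Suc K) * int L" by simp
    with that show ?thesis by linarith
  qed
  show ?case
  proof (cases "y \<le> p")
    case True
    have V: "?V n \<le> ?V t"
      unfolding n by (rule strip_visits_mono) simp
    obtain s t' R D where IH: "trail (int L) s t' (?X n) D" "simulates \<omega> L M y (?C n) R D"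
      "R \<le> ?V n" "t' \<le> n + (2 * K + 5) * ?V n + Suc K" "\<forall>z. D z \<noteq> [] \<longrightarrow> s \<le> z"
      "y - int L - int (Suc K) * int L \<le> s" "s < y - int (Suc K) * int L"
      using less.IH[of n] n True V less.prems unfolding p_def by auto
    obtain D' where D': "trail (int L) s (Suc t') (?X t) D'" "simulates \<omega> L M y (?C t) R D'"
      "\<forall>z. D' z \<noteq> [] \<longrightarrow> s \<le> z"
      using above[OF _ IH(1,2,5) below_y[OF IH(7)]] True unfolding n p_def by blast
    have "(2 * K + 5) * ?V n \<le> (2 * K + 5) * ?V t"
      using V by (rule mult_left_mono) simp
    then have "Suc t' \<le> t + (2 * K + 5) * ?V t + Suc K"
      using IH(4) n by linarith
    moreover have "R \<le> ?V t" using IH(3) V by simp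
    ultimately show ?thesis
      using D' IH(6,7) by blast
  next
    case False
    then have p: "p \<in> ?S"
      using less.prems(1) d unfolding Xt by auto
    have Vt: "?V t = Suc (?V n)"
      unfolding n by (rule strip_visits_Suc) (use p p_def in simp)
    have cross: "y \<le> p + \<omega> (?C n p, p)"
      using less.prems(1) unfolding Xt d_def .
    define P where "P i \<longleftrightarrow> i \<le> n \<and> (\<forall>j. i \<le> j \<longrightarrow> j \<le> n \<longrightarrow> ?X j < y)" for i
    define t0 where "t0 = (LEAST i. P i)"
    have "P n" using False by (auto simp: P_def p_def)
    then have Pt0: "P t0"
      unfolding t0_def by (rule LeastI)
    have C_above: "?C n z = ?C t0 z" if "z \<ge> y" for z
      by (rule cnt_eq_if_avoided) (use Pt0 that in \<open>force simp: P_def\<close>)+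
    show ?thesis
    proof (cases t0)
      case 0
      (* The first crossing of y: the trail starts Suc K rows below p, deeper than the machine
         will ever get, and arrives through the lane of p. *)
      define s where "s = p - int (Suc K) * int L"
      define A where "A = {s + int i * int L |i. i < Suc K}"
      define D where "D = push A (int L) (\<lambda>_. [])"
      have A: "s \<le> z \<and> z < y - int L" if "z \<in> A" for z
      proof -
        from that obtain i where i: "i < Suc K" "z = s + int i * int L"
          by (auto simp: A_def)
        have "(int i + 1) * int L \<le> int (Suc K) * int L"
          using i by (intro mult_right_mono) auto
        moreover have "(int i + 1) * int L = int i * int L + int L" "0 \<le> int i * int L"
          by (auto simp: algebra_simps)
        ultimately show ?thesis
          using p unfolding i(2) s_def atLeastLessThan_iff by linarith
      qed
      have "trail (int L) s (0 + Suc K) (s + int (Suc K) * int L) D"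
        unfolding D_def A_def by (rule trail_lane[OF trail.start]) (use L in auto)
      then have tr: "trail (int L) s (Suc K) p D"
        by (simp add: s_def)
      have D_strip: "D z = []" if "z \<ge> y - int L" for z
        using A[of z] that by (auto simp: D_def push_def)
      have "machine_off \<omega> L M y D"
        unfolding machine_off_def[OF env L M]
        using D_strip M by (auto simp: D_def push_def)
      moreover have "faithful \<omega> L M y (?C n) D"
        unfolding faithful_def[OF env L M] using D_strip C_above 0 L by auto
      ultimately have simulates: "simulates \<omega> L M y (?C n) 0 D"
        unfolding simulates_def[OF env L M] by blast
      have "0 \<le> int (Suc K) * int L" by simp
      then have s: "y - int L - int (Suc K) * int L \<le> s" "s < y - int (Suc K) * int L" "s \<le> p"
        using p unfolding s_def atLeastLessThan_iff by linarith+
      have "\<forall>z. (D(p := D p @ [\<omega> (?C n p, p)])) z \<noteq> [] \<longrightarrow> s \<le> z"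
        using A s(3) by (auto simp: D_def push_def)
      moreover have "trail (int L) s (Suc (Suc K)) (?X t) (D(p := D p @ [\<omega> (?C n p, p)]))"
        unfolding Xt d_def by (rule trail.step[OF tr envs_range[OF env]])
      moreover have "simulates \<omega> L M y (?C t) 0 (D(p := D p @ [\<omega> (?C n p, p)]))"
        unfolding Ct by (rule simulates_land[OF env L M simulates p cross])
      moreover have "Suc (Suc K) \<le> t + (2 * K + 5) * ?V t + Suc K"
        using n by simp
      ultimately show ?thesis
        using s(1,2) by blast
    next
      case (Suc m)
      have m: "y \<le> ?X m"
      proof (rule ccontr)
        assume "\<not> y \<le> ?X m"
        then have "P m"
          using Pt0 Suc unfolding P_def by (metis Suc_leD Suc_leI le_neq_implies_less not_le)
        then have "t0 \<le> m"
          unfolding t0_def by (rule Least_le)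
        then show False using Suc by simp
      qed
      have t0n: "t0 \<le> n" "?X t0 < y"
        using Pt0 by (auto simp: P_def)
      (* The last stay below y began at time t0 = Suc m, with a landing at u. *)
      define u where "u = ?X t0"
      have u: "u \<in> ?S"
        using pos_step[OF env, of 0 m] m t0n(2) unfolding u_def Suc by auto
      have Vm: "Suc (?V m) \<le> ?V t"
        unfolding Vt using t0n Suc by (simp add: strip_visits_mono)
      obtain s t' R D where IH: "trail (int L) s t' (?X m) D" "simulates \<omega> L M y (?C m) R D"
        "R \<le> ?V m" "t' \<le> m + (2 * K + 5) * ?V m + Suc K" "\<forall>z. D z \<noteq> [] \<longrightarrow> s \<le> z"
        "y - int L - int (Suc K) * int L \<le> s" "s < y - int (Suc K) * int L"
        using less.IH[of m] n m Suc t0n Vm less.prems by auto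
      obtain D1 where D1: "trail (int L) s (Suc t') u D1" "simulates \<omega> L M y (?C t0) R D1"
        "\<forall>z. D1 z \<noteq> [] \<longrightarrow> s \<le> z"
        using above[OF m IH(1,2,5) below_y[OF IH(7)]] unfolding Suc u_def by blast
      have dive: "?C t0 u < ?C n u" "u + \<omega> (?C t0 u, u) < y" if "u \<noteq> p"
      proof -
        have "t0 < n"
          using that t0n(1) unfolding u_def p_def by (cases "t0 = n") auto
        then show "u + \<omega> (?C t0 u, u) < y"
          using Pt0 unfolding P_def u_def by (metis Suc_leI le_SucI order_refl pos_Suc)
        have "?C (Suc t0) u \<le> ?C n u"
          by (rule cnt_mono) (use \<open>t0 < n\<close> in simp)
        then show "?C t0 u < ?C n u"
          by (simp add: cnt_Suc u_def)
      qed
      obtain t'' R' D' where D': "trail (int L) s t'' (p + \<omega> (?C n p, p)) D'"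
        "simulates \<omega> L M y ((?C n)(p := Suc (?C n p))) R' D'" "t'' \<le> Suc t' + 2 * R + 5" "R' \<le> Suc R"
        "\<And>z. D' z \<noteq> [] \<Longrightarrow> D1 z \<noteq> [] \<or> y - int L - int (Suc R) * int L \<le> z"
        using simulates_cross[OF env L M D1(1,2) u p C_above cnt_mono[OF t0n(1)] dive cross] by metis
      have RK: "Suc R \<le> K"
        using IH(3) Vm less.prems(2) by simp
      have "int (Suc R) * int L \<le> int K * int L"
        using RK by (intro mult_right_mono) auto
      moreover have "int (Suc K) * int L = int K * int L + int L"
        by (simp add: algebra_simps)
      ultimately have "s \<le> y - int L - int (Suc R) * int L"
        using IH(7) by linarith
      then have low: "\<forall>z. D' z \<noteq> [] \<longrightarrow> s \<le> z"
        using D'(5) D1(3) order_trans by blast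
      have "(2 * K + 5) * Suc (?V m) \<le> (2 * K + 5) * ?V t"
        using Vm by (rule mult_left_mono) simp
      then have "t'' \<le> t + (2 * K + 5) * ?V t + Suc K"
        using D'(3) IH(4) RK n t0n(1) Suc by simp
      moreover have "R' \<le> ?V t"
        using D'(4) IH(3) Vm by simp
      ultimately show ?thesis
        using D'(1,2) low IH(6,7) unfolding Xt Ct d_def by blast
    qed
  qed
qed

text \<open>
  The environment is modified only in a window below \<open>y\<close> whose length depends on the number \<open>K\<close> of
  visits to the strip alone.  The modified walk starts in this window, gets as far as the
  original one, and never returns below its starting point.
\<close>

lemma reflection:
  assumes env: "\<omega> \<in> envs L M" and L: "L \<ge> 1" and M: "M \<ge> 3" and "0 < y"
    and "y \<le> pos \<omega> 0 t" and K: "strip_visits \<omega> L y t \<le> K"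
  obtains \<omega>' s t' where "\<omega>' \<in> envs L M"
    "\<And>j z. z \<ge> y \<or> z < y - int (K + 2) * int L \<Longrightarrow> \<omega>' (j, z) = \<omega> (j, z)"
    "y - int (K + 2) * int L \<le> s" "s < y" "t' \<le> t + (2 * K + 6) * (K + 1)"
    "pos \<omega>' s t' = pos \<omega> 0 t" "\<And>j. j \<le> t' \<Longrightarrow> s \<le> pos \<omega>' s j"
proof -
  obtain s t' R D where D: "trail (int L) s t' (pos \<omega> 0 t) D" "simulates \<omega> L M y (cnt \<omega> 0 t) R D"
    "t' \<le> t + (2 * K + 5) * strip_visits \<omega> L y t + Suc K" "\<And>z. D z \<noteq> [] \<Longrightarrow> s \<le> z"
    "y - int L - int (Suc K) * int L \<le> s" "s < y - int (Suc K) * int L"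
    using simulation[OF assms] by metis
  have K2: "int (K + 2) * int L = int (Suc K) * int L + int L" "0 \<le> int (Suc K) * int L"
    by (auto simp: algebra_simps)
  then have s: "y - int (K + 2) * int L \<le> s" "s < y"
    using D(5,6) by linarith+
  define \<omega>' where "\<omega>' = (\<lambda>(j, z). if y - int (K + 2) * int L \<le> z \<and> z < y
      then if min j (M - 1) < length (D z) then D z ! min j (M - 1) else 0 else \<omega> (j, z))"
  have "\<omega>' \<in> envs L M"
  proof -
    have "\<bar>\<omega>' (j, z)\<bar> \<le> int L" for j z
      using trail_jumps[OF D(1), of "D z ! min j (M - 1)" z] envs_range[OF env, of j z]
      by (auto simp: \<omega>'_def)
    then have "\<omega>' (j, z) \<in> {- int L..int L}" for j z
      by (simp add: abs_le_iff minus_le_iff)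
    moreover have "\<omega>' (j, z) = \<omega>' (M - 1, z)" if "j \<ge> M - 1" for j z
      using that envs_tail[OF env that, of z] by (auto simp: \<omega>'_def min_def)
    ultimately show ?thesis
      unfolding envs_def by blast
  qed
  moreover have follow: "\<omega>' (k, z) = D z ! k" if k: "k < length (D z)" for k z
  proof (cases "z < y")
    case True
    have "D z \<noteq> []" using k by auto
    then have "s \<le> z" by (rule D(4))
    moreover have "D z ! min k (M - 1) = D z ! k"
      using simulates_settled[OF env L M D(2), of k z] k by (auto simp: min_def)
    ultimately show ?thesis
      using True s k by (auto simp: \<omega>'_def)
  next
    case False
    then have "D z = map (\<lambda>k. \<omega> (k, z)) [0..<cnt \<omega> 0 t z]"
      using D(2) unfolding simulates_def[OF env L M] faithful_def[OF env L M] by auto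
    with k have "D z ! k = \<omega> (k, z)" by simp
    then show ?thesis using False by (simp add: \<omega>'_def)
  qed
  moreover have "s \<le> pos \<omega>' s j" if "j \<le> t'" for j
  proof (cases "j = t'")
    case True
    with trail_pos(1)[OF D(1) follow] assms(5) s(2) show ?thesis by simp
  next
    case False
    with that trail_pos(3)[OF D(1) follow, of j] show ?thesis
      by (intro D(4)) simp
  qed
  moreover have "(2 * K + 5) * strip_visits \<omega> L y t \<le> (2 * K + 5) * K"
    using K by (rule mult_left_mono) simp
  then have "t' \<le> t + (2 * K + 6) * (K + 1)"
    using D(3) by (simp add: algebra_simps)
  ultimately show thesis
    using s trail_pos(1)[OF D(1) follow] by (intro that[of \<omega>' s t']) (auto simp: \<omega>'_def)
qed

section \<open>Probabilities of environments\<close>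

locale cookie_walk =
  fixes L M :: nat and \<mu> :: "int pmf"
  assumes L: "L \<ge> 1" and M: "M \<ge> 3" and supp: "set_pmf \<mu> = {- int L..int L}"
begin

abbreviation E :: "env measure" where "E \<equiv> env_measure L M \<mu>"
abbreviation C :: "int measure" where "C \<equiv> cookie_space L \<mu>"

definition Pr :: "(env \<Rightarrow> bool) \<Rightarrow> real" where
  "Pr Q = measure E {\<omega> \<in> envs L M. Q \<omega>}"

definition cmin :: real where "cmin = Min (pmf \<mu> ` {- int L..int L})"

sublocale prob_space E
  by (rule prob_space_env_measure) (use M supp in auto)

lemma M1: "M \<ge> 1"
  using M by simp

lemma cmin_pos: "cmin > 0"
  unfolding cmin_def by (subst Min_gr_iff) (use supp in \<open>auto simp: pmf_positive_iff\<close>)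

lemma cmin_le: "\<bar>k\<bar> \<le> int L \<Longrightarrow> cmin \<le> pmf \<mu> k"
  unfolding cmin_def by (intro Min_le imageI) auto

lemma cmin_le_1: "cmin \<le> 1"
  using cmin_le[of 0] pmf_le_1[of \<mu> 0] by simp

lemma pred_iff: "Measurable.pred E Q \<longleftrightarrow> {\<omega> \<in> envs L M. Q \<omega>} \<in> sets E"
  by (simp add: pred_def)

lemma Pr_nonneg: "Pr Q \<ge> 0" and Pr_le_1: "Pr Q \<le> 1"
  by (auto simp: Pr_def)

lemma Pr_mono:
  assumes "Measurable.pred E Q'" "\<And>\<omega>. \<omega> \<in> envs L M \<Longrightarrow> Q \<omega> \<Longrightarrow> Q' \<omega>"
  shows "Pr Q \<le> Pr Q'"
  unfolding Pr_def using assms by (intro finite_measure_mono) (auto simp: pred_iff)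

lemma Pr_cong: "(\<And>\<omega>. \<omega> \<in> envs L M \<Longrightarrow> Q \<omega> = Q' \<omega>) \<Longrightarrow> Pr Q = Pr Q'"
  unfolding Pr_def by (metis (mono_tags, lifting) Collect_cong)

lemma Pr_True: "Pr (\<lambda>_. True) = 1"
  using prob_space by (simp add: Pr_def)

lemma Pr_union:
  assumes "finite A" "\<And>a. a \<in> A \<Longrightarrow> Measurable.pred E (Q a)"
    "\<And>\<omega>. \<omega> \<in> envs L M \<Longrightarrow> R \<omega> \<Longrightarrow> \<exists>a\<in>A. Q a \<omega>"
  shows "Pr R \<le> (\<Sum>a\<in>A. Pr (Q a))"
proof -
  have "measure E {\<omega> \<in> envs L M. R \<omega>} \<le> measure E (\<Union>a\<in>A. {\<omega> \<in> envs L M. Q a \<omega>})"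
    using assms by (intro finite_measure_mono) (auto simp: pred_iff)
  also have "\<dots> \<le> (\<Sum>a\<in>A. measure E {\<omega> \<in> envs L M. Q a \<omega>})"
    using assms by (intro finite_measure_subadditive_finite) (auto simp: pred_iff)
  finally show ?thesis by (simp add: Pr_def)
qed

lemma Pr_disjoint:
  assumes "finite A" "\<And>a. a \<in> A \<Longrightarrow> Measurable.pred E (Q a)" "Measurable.pred E R"
    "\<And>\<omega> a. \<omega> \<in> envs L M \<Longrightarrow> a \<in> A \<Longrightarrow> Q a \<omega> \<Longrightarrow> R \<omega>"
    "\<And>\<omega> a b. \<omega> \<in> envs L M \<Longrightarrow> a \<in> A \<Longrightarrow> b \<in> A \<Longrightarrow> Q a \<omega> \<Longrightarrow> Q b \<omega> \<Longrightarrow> a = b"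
  shows "(\<Sum>a\<in>A. Pr (Q a)) \<le> Pr R"
proof -
  have "(\<Sum>a\<in>A. Pr (Q a)) = measure E (\<Union>a\<in>A. {\<omega> \<in> envs L M. Q a \<omega>})"
    unfolding Pr_def using assms
    by (intro finite_measure_finite_Union[symmetric])
       (auto simp: pred_iff disjoint_family_on_def)
  also have "\<dots> \<le> Pr R"
    unfolding Pr_def using assms by (intro finite_measure_mono) (auto simp: pred_iff)
  finally show ?thesis .
qed

subsection \<open>Measurability\<close>

lemma measurable_into_env:
  assumes "\<And>i. (\<lambda>x. f x i) \<in> N \<rightarrow>\<^sub>M count_space UNIV"
    and "\<And>x. x \<in> space N \<Longrightarrow> f x \<in> envs L M"
  shows "f \<in> N \<rightarrow>\<^sub>M E"
proof -
  have "f \<in> N \<rightarrow>\<^sub>M PiM UNIV (\<lambda>_. count_space UNIV)"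
    by (rule measurable_PiM_single') (use assms in auto)
  then have "f \<in> N \<rightarrow>\<^sub>M env_space L M"
    unfolding env_space_def using assms(2) by (intro measurable_restrict_space2) auto
  then show ?thesis
    using measurable_cong_sets[OF refl sets_env_measure[of L M \<mu>]] by blast
qed

lemma measurable_cookie': "(\<lambda>\<omega>. \<omega> i) \<in> E \<rightarrow>\<^sub>M count_space UNIV"
  by (rule measurable_compose[OF measurable_cookie])
     (auto simp: measurable_def sets_cookie_space)

lemma measurable_shift: "shift_env s \<in> E \<rightarrow>\<^sub>M E"
proof (rule measurable_into_env)
  fix i show "(\<lambda>\<omega>. shift_env s \<omega> i) \<in> E \<rightarrow>\<^sub>M count_space UNIV"
    using measurable_cookie'[of "(fst i, snd i + s)"]
    by (cases i) (simp add: shift_env_def)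
qed (simp add: shift_env_in_envs)

definition override :: "int set \<Rightarrow> env \<Rightarrow> env \<Rightarrow> env" where
  "override Z G \<omega> = (\<lambda>(j, z). if z \<in> Z then G (j, z) else \<omega> (j, z))"

lemma envsI:
  assumes "\<And>j z. \<bar>\<omega> (j, z)\<bar> \<le> int L" "\<And>j z. j \<ge> M - 1 \<Longrightarrow> \<omega> (j, z) = \<omega> (M - 1, z)"
  shows "\<omega> \<in> envs L M"
proof -
  have "\<omega> (j, z) \<in> {- int L..int L}" for j z
    using assms(1)[of j z] by auto
  with assms(2) show ?thesis
    unfolding envs_def by blast
qed

lemma override_in_envs: "G \<in> envs L M \<Longrightarrow> \<omega> \<in> envs L M \<Longrightarrow> override Z G \<omega> \<in> envs L M"
  by (rule envsI) (auto simp: override_def envs_range dest: envs_tail)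

lemma measurable_override:
  assumes "G \<in> envs L M"
  shows "override Z G \<in> E \<rightarrow>\<^sub>M E"
proof (rule measurable_into_env)
  fix i show "(\<lambda>\<omega>. override Z G \<omega> i) \<in> E \<rightarrow>\<^sub>M count_space UNIV"
    using measurable_cookie'[of i] by (cases i) (auto simp: override_def)
qed (use assms in \<open>simp add: override_in_envs\<close>)

lemma measurable_pos [measurable]: "(\<lambda>\<omega>. pos \<omega> s t) \<in> E \<rightarrow>\<^sub>M count_space UNIV"
proof -
  have "(\<lambda>\<omega>. s + walk (shift_env s \<omega>) t) \<in> E \<rightarrow>\<^sub>M count_space UNIV"
    by (rule measurable_compose[OF measurable_compose[OF measurable_shift measurable_walk]]) simp
  then show ?thesis
    by (subst pos_shift) (simp add: walk_eq_pos)
qed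

lemma pred_compose: "f \<in> E \<rightarrow>\<^sub>M E \<Longrightarrow> Measurable.pred E Q \<Longrightarrow> Measurable.pred E (\<lambda>\<omega>. Q (f \<omega>))"
  by (rule measurable_compose[of f E E Q])

subsection \<open>Independence and stationarity\<close>

text \<open>
  Dependence on a set of sites is expressed by invariance under changes elsewhere.  Such an event
  can be evaluated on an environment in which the other sites have been emptied, and this turns it into
  an event about a restricted family of cookies.
\<close>

lemma Pr_indep:
  assumes Q: "Measurable.pred E Q1" "Measurable.pred E Q2" and AB: "A \<inter> B = {}"
    and dep1: "\<And>\<omega> \<omega>'. \<omega> \<in> envs L M \<Longrightarrow> \<omega>' \<in> envs L M \<Longrightarrow>
      (\<And>j z. z \<in> A \<Longrightarrow> \<omega> (j, z) = \<omega>' (j, z)) \<Longrightarrow> Q1 \<omega> \<Longrightarrow> Q1 \<omega>'"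
    and dep2: "\<And>\<omega> \<omega>'. \<omega> \<in> envs L M \<Longrightarrow> \<omega>' \<in> envs L M \<Longrightarrow>
      (\<And>j z. z \<in> B \<Longrightarrow> \<omega> (j, z) = \<omega>' (j, z)) \<Longrightarrow> Q2 \<omega> \<Longrightarrow> Q2 \<omega>'"
  shows "Pr (\<lambda>\<omega>. Q1 \<omega> \<and> Q2 \<omega>) = Pr Q1 * Pr Q2"
proof -
  let ?I = "\<lambda>Z. {..<M} \<times> Z"
  define fill where "fill Z c = (\<lambda>(j, z). if z \<in> Z then c (min j (M - 1), z) else 0)"
    for Z and c :: env
  define cut where "cut Z \<omega> = restrict (\<lambda>i. \<omega> i) (?I Z)" for Z and \<omega> :: env
  have minM: "min j (M - 1) < M" for j
    using M by auto
  have fill: "fill Z \<in> PiM (?I Z) (\<lambda>_. C) \<rightarrow>\<^sub>M E" for Z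
  proof (rule measurable_into_env)
    fix i :: "nat \<times> int"
    obtain j z where i: "i = (j, z)" by (cases i)
    have "(\<lambda>c. c (min j (M - 1), z)) \<in> PiM (?I Z) (\<lambda>_. C) \<rightarrow>\<^sub>M count_space UNIV" if "z \<in> Z"
    proof -
      have "(\<lambda>c. c (min j (M - 1), z)) \<in> PiM (?I Z) (\<lambda>_. C) \<rightarrow>\<^sub>M C"
        using that minM by (intro measurable_component_singleton) auto
      moreover have "(\<lambda>x. x) \<in> C \<rightarrow>\<^sub>M count_space UNIV"
        by (auto simp: measurable_def sets_cookie_space)
      ultimately show ?thesis by (rule measurable_compose)
    qed
    then show "(\<lambda>c. fill Z c i) \<in> PiM (?I Z) (\<lambda>_. C) \<rightarrow>\<^sub>M count_space UNIV"
      unfolding fill_def i by (cases "z \<in> Z") simp_all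
  next
    fix c assume c: "c \<in> space (PiM (?I Z) (\<lambda>_. C))"
    have "c (min j (M - 1), z) \<in> {- int L..int L}" if "z \<in> Z" for j z
      using c that minM by (auto simp: space_PiM PiE_def Pi_def)
    then show "fill Z c \<in> envs L M"
      by (auto simp: envs_def fill_def)
  qed
  have fill_cut: "fill Z (cut Z \<omega>) (j, z) = \<omega> (j, z)" if "\<omega> \<in> envs L M" "z \<in> Z" for Z \<omega> j z
  proof -
    have "\<omega> (min j (M - 1), z) = \<omega> (j, z)"
      using envs_tail[OF that(1), of j z] by (auto simp: min_def)
    with that(2) minM show ?thesis by (simp add: fill_def cut_def)
  qed
  have cut: "cut Z \<in> E \<rightarrow>\<^sub>M PiM (?I Z) (\<lambda>_. C)" for Z
    unfolding cut_def by (intro measurable_restrict measurable_cookie)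
  have fc: "fill Z (cut Z \<omega>) \<in> envs L M" if "\<omega> \<in> envs L M" for Z \<omega>
    using measurable_space[OF measurable_compose[OF cut fill]] that by simp
  have eq1: "Q1 (fill A (cut A \<omega>)) \<longleftrightarrow> Q1 \<omega>" if "\<omega> \<in> envs L M" for \<omega>
    using dep1[OF that fc[OF that]] dep1[OF fc[OF that] that] fill_cut[OF that] by metis
  have eq2: "Q2 (fill B (cut B \<omega>)) \<longleftrightarrow> Q2 \<omega>" if "\<omega> \<in> envs L M" for \<omega>
    using dep2[OF that fc[OF that]] dep2[OF fc[OF that] that] fill_cut[OF that] by metis
  define X1 where "X1 = fill A -` {\<omega> \<in> envs L M. Q1 \<omega>} \<inter> space (PiM (?I A) (\<lambda>_. C))"
  define X2 where "X2 = fill B -` {\<omega> \<in> envs L M. Q2 \<omega>} \<inter> space (PiM (?I B) (\<lambda>_. C))"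
  have sets: "X1 \<in> sets (PiM (?I A) (\<lambda>_. C))" "X2 \<in> sets (PiM (?I B) (\<lambda>_. C))"
    unfolding X1_def X2_def by (intro measurable_sets[OF fill]; use Q in \<open>simp add: pred_iff\<close>)+
  have "indep_var (PiM (?I A) (\<lambda>_. C)) (cut A) (PiM (?I B) (\<lambda>_. C)) (cut B)"
    unfolding cut_def
    by (rule indep_var_restrict[OF env_measure_iid(1)[OF M1 supp]]) (use AB in auto)
  from indep_varD[OF this sets]
  have *: "prob ((\<lambda>x. (cut A x, cut B x)) -` (X1 \<times> X2) \<inter> space E) =
      prob (cut A -` X1 \<inter> space E) * prob (cut B -` X2 \<inter> space E)" .
  have cs: "cut Z \<omega> \<in> space (PiM (?I Z) (\<lambda>_. C))" if "\<omega> \<in> envs L M" for Z \<omega>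
    using measurable_space[OF cut] that by simp
  have "cut A -` X1 \<inter> space E = {\<omega> \<in> envs L M. Q1 \<omega>}"
    using cs fc eq1 by (auto simp: X1_def)
  moreover have "cut B -` X2 \<inter> space E = {\<omega> \<in> envs L M. Q2 \<omega>}"
    using cs fc eq2 by (auto simp: X2_def)
  moreover from calculation
  have "(\<lambda>x. (cut A x, cut B x)) -` (X1 \<times> X2) \<inter> space E = {\<omega> \<in> envs L M. Q1 \<omega> \<and> Q2 \<omega>}"
    by blast
  ultimately show ?thesis
    using * by (simp add: Pr_def)
qed

lemma distr_shift: "distr E E (shift_env s) = E"
proof -
  let ?I = "{..<M} \<times> (UNIV :: int set)"
  let ?Pr = "PiM ?I (\<lambda>_. C)"
  define r where "r = (\<lambda>c :: env. \<lambda>i\<in>?I. c (fst i, snd i + s))"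
  have E: "E = distr ?Pr (env_space L M) (extend_cookies M)"
    by (simp add: env_measure_def)
  have ext: "extend_cookies M \<in> ?Pr \<rightarrow>\<^sub>M env_space L M"
    by (rule measurable_extend_cookies[OF M1])
  have cs: "sets E = sets (env_space L M)"
    by (rule sets_env_measure)
  have sh: "shift_env s \<in> env_space L M \<rightarrow>\<^sub>M env_space L M"
    using measurable_shift[of s] measurable_cong_sets[OF cs cs] by blast
  have r: "r \<in> ?Pr \<rightarrow>\<^sub>M ?Pr"
    unfolding r_def by (intro measurable_restrict measurable_component_singleton) auto
  have rP: "distr ?Pr ?Pr r = ?Pr"
    unfolding r_def
    by (rule distr_PiM_reindex[where f = "\<lambda>i. (fst i, snd i + s)" and M = "\<lambda>_. C" and K = ?I and I = ?I])
       (use prob_space_cookie_space[OF supp] in \<open>auto simp: inj_on_def\<close>)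
  have "distr E E (shift_env s) = distr E (env_space L M) (shift_env s)"
    by (rule distr_cong) (simp_all add: cs)
  also have "\<dots> = distr ?Pr (env_space L M) (shift_env s \<circ> extend_cookies M)"
    unfolding E by (rule distr_distr[OF sh ext])
  also have "\<dots> = distr ?Pr (env_space L M) (extend_cookies M \<circ> r)"
  proof (rule distr_cong)
    fix c
    show "(shift_env s \<circ> extend_cookies M) c = (extend_cookies M \<circ> r) c"
      using M by (auto simp: shift_env_def extend_cookies_def r_def fun_eq_iff min_def)
  qed simp_all
  also have "\<dots> = distr (distr ?Pr ?Pr r) (env_space L M) (extend_cookies M)"
    by (rule distr_distr[OF ext r, symmetric])
  also have "\<dots> = E"
    unfolding rP by (simp add: E)
  finally show ?thesis .
qed

lemma Pr_shift:
  assumes "Measurable.pred E Q"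
  shows "Pr (\<lambda>\<omega>. Q (shift_env s \<omega>)) = Pr Q"
proof -
  have "Pr Q = measure (distr E E (shift_env s)) {\<omega> \<in> envs L M. Q \<omega>}"
    by (simp add: distr_shift Pr_def)
  also have "\<dots> = measure E (shift_env s -` {\<omega> \<in> envs L M. Q \<omega>} \<inter> space E)"
    using assms by (intro measure_distr measurable_shift) (simp add: pred_iff)
  also have "shift_env s -` {\<omega> \<in> envs L M. Q \<omega>} \<inter> space E = {\<omega> \<in> envs L M. Q (shift_env s \<omega>)}"
    by (auto simp: shift_env_in_envs)
  finally show ?thesis by (simp add: Pr_def)
qed

lemma pred_pattern:
  assumes "finite Z" "G \<in> envs L M"
  shows "Measurable.pred E (\<lambda>\<omega>. \<forall>i\<in>{..<M} \<times> Z. \<omega> i = G i)"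
proof -
  have "Measurable.pred E (\<lambda>\<omega>. \<omega> i = G i)" for i
    by (rule measurable_compose[OF measurable_cookie'[of i]]) simp
  then show ?thesis
    using assms by (intro pred_intros_finite) auto
qed

lemma Pr_pattern:
  assumes "finite Z" "G \<in> envs L M"
  shows "cmin ^ (M * card Z) \<le> Pr (\<lambda>\<omega>. \<forall>i\<in>{..<M} \<times> Z. \<omega> i = G i)"
proof (cases "Z = {}")
  case True
  then show ?thesis by (simp add: Pr_True)
next
  case False
  let ?J = "{..<M} \<times> Z"
  have J: "finite ?J" "?J \<noteq> {}" "?J \<subseteq> {..<M} \<times> UNIV"
    using assms(1) False M by (auto simp: lessThan_empty_iff)
  have one: "cmin \<le> prob ((\<lambda>\<omega>. \<omega> i) -` {G i} \<inter> space E)" if "i \<in> ?J" for i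
  proof -
    have Gi: "\<bar>G i\<bar> \<le> int L"
      using envs_range[OF assms(2), of "fst i" "snd i"] by simp
    have "prob ((\<lambda>\<omega>. \<omega> i) -` {G i} \<inter> space E) = measure (distr E C (\<lambda>\<omega>. \<omega> i)) {G i}"
      using Gi by (intro measure_distr[symmetric] measurable_cookie) (auto simp: sets_cookie_space)
    also have "distr E C (\<lambda>\<omega>. \<omega> i) = C"
      using J(3) that by (intro env_measure_iid(2)[OF M1 supp]) auto
    also have "measure C {G i} = pmf \<mu> (G i)"
      using Gi by (simp add: cookie_space_def measure_restrict_space abs_le_iff minus_le_iff pmf.rep_eq)
    finally show ?thesis
      using cmin_le[OF Gi] by simp
  qed
  have "cmin ^ (M * card Z) = (\<Prod>i\<in>?J. cmin)"
    by (simp add: card_cartesian_product)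
  also have "\<dots> \<le> (\<Prod>i\<in>?J. prob ((\<lambda>\<omega>. \<omega> i) -` {G i} \<inter> space E))"
    using one cmin_pos by (intro prod_mono) auto
  also have "\<dots> = prob (\<Inter>i\<in>?J. (\<lambda>\<omega>. \<omega> i) -` {G i} \<inter> space E)"
  proof (rule indep_varsD[OF env_measure_iid(1)[OF M1 supp] J(2,1,3), symmetric])
    fix i
    show "{G i} \<in> sets C"
      using envs_range[OF assms(2), of "fst i" "snd i"] by (auto simp: sets_cookie_space)
  qed
  also have "(\<Inter>i\<in>?J. (\<lambda>\<omega>. \<omega> i) -` {G i} \<inter> space E) = {\<omega> \<in> envs L M. \<forall>i\<in>?J. \<omega> i = G i}"
    using J(2) by auto
  finally show ?thesis by (simp add: Pr_def)
qed

text \<open>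
  The price for prescribing the cookies on finitely many sites: if \<open>Q\<close> holds after \<open>G\<close> has been
  installed on \<open>Z\<close>, then \<open>Q\<close> holds in the original environment whenever this agrees
  with \<open>G\<close> on \<open>Z\<close>, and this is independent of the rest of the environment.
\<close>

lemma Pr_override:
  assumes Z: "finite Z" and G: "G \<in> envs L M" and Q: "Measurable.pred E Q"
  shows "cmin ^ (M * card Z) * Pr (\<lambda>\<omega>. Q (override Z G \<omega>)) \<le> Pr Q"
proof -
  let ?pat = "\<lambda>\<omega>. \<forall>i\<in>{..<M} \<times> Z. \<omega> i = G i"
  have pQ: "Measurable.pred E (\<lambda>\<omega>. Q (override Z G \<omega>))"
    by (rule pred_compose[OF measurable_override[OF G] Q])
  have "cmin ^ (M * card Z) * Pr (\<lambda>\<omega>. Q (override Z G \<omega>)) \<le> Pr ?pat * Pr (\<lambda>\<omega>. Q (override Z G \<omega>))"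
    by (intro mult_right_mono Pr_pattern[OF Z G] Pr_nonneg)
  also have "\<dots> = Pr (\<lambda>\<omega>. ?pat \<omega> \<and> Q (override Z G \<omega>))"
  proof (rule Pr_indep[symmetric, where A = Z and B = "- Z"])
    fix \<omega> \<omega>' :: env
    assume "\<And>j z. z \<in> - Z \<Longrightarrow> \<omega> (j, z) = \<omega>' (j, z)" and "Q (override Z G \<omega>)"
    moreover from this(1) have "override Z G \<omega> = override Z G \<omega>'"
      by (auto simp: override_def fun_eq_iff)
    ultimately show "Q (override Z G \<omega>')" by simp
  qed (use pred_pattern[OF Z G] pQ in auto)
  also have "\<dots> \<le> Pr Q"
  proof (rule Pr_mono[OF Q])
    fix \<omega> assume \<omega>: "\<omega> \<in> envs L M" and "?pat \<omega> \<and> Q (override Z G \<omega>)"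
    moreover have "override Z G \<omega> = \<omega>" if pat: "?pat \<omega>"
    proof -
      have "G (j, z) = \<omega> (j, z)" if "z \<in> Z" for j z
        using pat that envs_tail[OF \<omega>, of j z] envs_tail[OF G, of j z] M
        by (cases "j < M") (auto simp: not_less)
      then show ?thesis by (auto simp: override_def fun_eq_iff)
    qed
    ultimately show "Q \<omega>" by auto
  qed
  finally show ?thesis .
qed

end

section \<open>Hitting and climbing\<close>

lemma pos_stuck:
  assumes "pos \<omega> s t = z" and "\<And>k. \<omega> (k, z) = 0"
  shows "pos \<omega> s (t + i) = z"
  by (induction i) (use assms in \<open>simp_all add: pos_Suc\<close>)

lemma pos_advance:
  assumes "\<omega> \<in> envs L M" "j \<le> t"
  shows "pos \<omega> s t \<le> pos \<omega> s j + int L * int (t - j)"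
  using assms(2)
proof (induction t rule: dec_induct)
  case (step t)
  have "pos \<omega> s (Suc t) \<le> pos \<omega> s t + int L"
    using pos_step[OF assms(1), of s t] by linarith
  with step show ?case by (simp add: Suc_diff_le algebra_simps)
qed simp

lemma sum_cnt_le: "finite S \<Longrightarrow> (\<Sum>z\<in>S. cnt \<omega> s t z) \<le> t"
proof (induction t)
  case (Suc t)
  have "(\<Sum>z\<in>S. cnt \<omega> s (Suc t) z) \<le> (\<Sum>z\<in>S. cnt \<omega> s t z + (if z = pos \<omega> s t then 1 else 0))"
    by (intro sum_mono) (simp add: cnt_Suc)
  also have "\<dots> \<le> Suc t"
    using Suc by (simp add: sum.distrib)
  finally show ?case .
qed simp

lemma first_hit:
  assumes "x \<le> pos \<omega> 0 t"
  obtains t0 where "t0 \<le> t" "x \<le> pos \<omega> 0 t0" "\<And>j. j < t0 \<Longrightarrow> pos \<omega> 0 j < x"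
proof
  let ?t = "LEAST t. x \<le> pos \<omega> 0 t"
  show "?t \<le> t" by (rule Least_le[of "\<lambda>t. x \<le> pos \<omega> 0 t", OF assms])
  show "x \<le> pos \<omega> 0 ?t" by (rule LeastI[of "\<lambda>t. x \<le> pos \<omega> 0 t", OF assms])
  show "pos \<omega> 0 j < x" if "j < ?t" for j
    using not_less_Least[OF that] by simp
qed

lemma first_hit_range:
  assumes "\<omega> \<in> envs L M" "L \<ge> 1" "0 \<le> x" "x \<le> pos \<omega> 0 t" "\<And>j. j < t \<Longrightarrow> pos \<omega> 0 j < x"
  shows "pos \<omega> 0 t \<in> {x..<x + int L}"
proof (cases t)
  case (Suc n)
  then have "pos \<omega> 0 n < x" using assms(5) by simp
  moreover have "pos \<omega> 0 t \<le> pos \<omega> 0 n + int L"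
    using pos_step[OF assms(1), of 0 n] unfolding Suc by linarith
  ultimately show ?thesis using assms(4) by simp
qed (use assms in simp)

context cookie_walk
begin

definition hits :: "nat \<Rightarrow> int \<Rightarrow> env \<Rightarrow> bool" where
  "hits n x \<omega> \<longleftrightarrow> (\<exists>t\<le>n. x \<le> pos \<omega> 0 t)"

definition climbs :: "nat \<Rightarrow> int \<Rightarrow> env \<Rightarrow> bool" where
  "climbs n x \<omega> \<longleftrightarrow> (\<exists>t\<le>n. x \<le> pos \<omega> 0 t \<and> (\<forall>j\<le>t. 0 \<le> pos \<omega> 0 j))"

definition hit_prob :: "nat \<Rightarrow> int \<Rightarrow> real" where "hit_prob n x = Pr (hits n x)"
definition climb_prob :: "nat \<Rightarrow> int \<Rightarrow> real" where "climb_prob n x = Pr (climbs n x)"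

text \<open>
  A lower bound for the probability that all cookies of a given site have prescribed values.
\<close>

definition pmin :: real where "pmin = cmin ^ M"

lemma pmin_pos: "0 < pmin" and pmin_le_1: "pmin \<le> 1"
  using cmin_pos cmin_le_1 by (auto simp: pmin_def power_le_one)

lemma pred_pos: "Measurable.pred E (\<lambda>\<omega>. R (pos \<omega> s t))"
  by (rule measurable_compose[OF measurable_pos]) simp

lemma pred_hits [measurable]: "Measurable.pred E (hits n x)"
  unfolding hits_def by (intro pred_intros_countable pred_intros_conj1' pred_pos)

lemma pred_climbs [measurable]: "Measurable.pred E (climbs n x)"
  unfolding climbs_def
  by (intro pred_intros_countable pred_intros_conj1' pred_intros_imp' pred_intros_logic pred_pos)

lemma climb_prob_le_hit_prob: "climb_prob n x \<le> hit_prob n x"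
  unfolding climb_prob_def hit_prob_def by (rule Pr_mono) (auto simp: climbs_def hits_def)

lemma climb_prob_mono: "n \<le> n' \<Longrightarrow> x' \<le> x \<Longrightarrow> climb_prob n x \<le> climb_prob n' x'"
  unfolding climb_prob_def by (rule Pr_mono[OF pred_climbs]) (meson climbs_def order_trans)

lemma climb_prob_nonneg: "0 \<le> climb_prob n x" and hit_prob_le_1: "hit_prob n x \<le> 1"
  by (auto simp: climb_prob_def hit_prob_def Pr_nonneg Pr_le_1)

subsection \<open>Freezing\<close>

text \<open>
  Emptying the site of the first hit leaves the path up to this time unchanged and stops the walk
  afterwards.  The first hit overshoots \<open>x\<close> by less than \<open>L\<close>.
\<close>

lemma freeze:
  assumes "0 \<le> x"
  shows "pmin * hit_prob n x \<le> Pr (\<lambda>\<omega>. x \<le> pos \<omega> 0 n \<and> (\<forall>t\<le>n. pos \<omega> 0 t < x + int L))"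
proof -
  let ?A = "\<lambda>z \<omega>. \<exists>t\<le>n. pos \<omega> 0 t = z \<and> (\<forall>j<t. pos \<omega> 0 j < x)"
  let ?F = "\<lambda>z \<omega>. pos \<omega> 0 n = z \<and> (\<forall>t\<le>n. pos \<omega> 0 t < x + int L)"
  let ?Z = "{x..<x + int L}"
  have pF: "Measurable.pred E (?F z)" for z
    by (intro pred_intros_countable pred_intros_conj1' pred_intros_imp' pred_intros_logic pred_pos)
  have pA: "Measurable.pred E (?A z)" for z
    by (intro pred_intros_countable pred_intros_conj1' pred_intros_imp' pred_intros_logic pred_pos)
  have zero: "(\<lambda>_. 0) \<in> envs L M"
    by (rule envsI) auto
  have step: "pmin * Pr (?A z) \<le> Pr (?F z)" if z: "z \<in> ?Z" for z
  proof -
    have "Pr (?A z) \<le> Pr (\<lambda>\<omega>. ?F z (override {z} (\<lambda>_. 0) \<omega>))"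
    proof (rule Pr_mono)
      show "Measurable.pred E (\<lambda>\<omega>. ?F z (override {z} (\<lambda>_. 0) \<omega>))"
        by (rule pred_compose[OF measurable_override[OF zero] pF])
    next
      fix \<omega> assume "\<omega> \<in> envs L M" "?A z \<omega>"
      then obtain t where t: "t \<le> n" "pos \<omega> 0 t = z" "\<forall>j<t. pos \<omega> 0 j < x" by blast
      let ?\<omega> = "override {z} (\<lambda>_. 0) \<omega>"
      have same: "pos ?\<omega> 0 i = pos \<omega> 0 i" if "i \<le> t" for i
        by (rule pos_agree[OF _ that]) (use t z in \<open>force simp: override_def\<close>)
      have stay: "pos ?\<omega> 0 i = z" if "t \<le> i" for i
        using pos_stuck[of ?\<omega> 0 t z "i - t"] same[of t] t(2) that by (simp add: override_def)
      have "pos ?\<omega> 0 i < x + int L" for i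
      proof (cases "i < t")
        case True
        with same[of i] t(3) show ?thesis by force
      qed (use stay[of i] z in auto)
      with stay[OF t(1)] show "?F z ?\<omega>" by blast
    qed
    then have "pmin * Pr (?A z) \<le> cmin ^ (M * card {z}) * Pr (\<lambda>\<omega>. ?F z (override {z} (\<lambda>_. 0) \<omega>))"
      using pmin_pos by (simp add: pmin_def)
    also have "\<dots> \<le> Pr (?F z)"
      by (rule Pr_override[OF _ zero pF]) simp
    finally show ?thesis .
  qed
  have "hit_prob n x \<le> (\<Sum>z\<in>?Z. Pr (?A z))"
    unfolding hit_prob_def
  proof (rule Pr_union[OF _ pA])
    fix \<omega> assume \<omega>: "\<omega> \<in> envs L M" "hits n x \<omega>"
    then obtain t where t: "t \<le> n" "x \<le> pos \<omega> 0 t" by (auto simp: hits_def)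
    obtain t0 where t0: "t0 \<le> t" "x \<le> pos \<omega> 0 t0" "\<And>j. j < t0 \<Longrightarrow> pos \<omega> 0 j < x"
      using first_hit[OF t(2)] by blast
    with first_hit_range[OF \<omega>(1) L assms t0(2,3)] t(1)
    show "\<exists>z\<in>?Z. ?A z \<omega>" by (intro bexI[of _ "pos \<omega> 0 t0"] exI[of _ t0]) auto
  qed simp
  then have "pmin * hit_prob n x \<le> pmin * (\<Sum>z\<in>?Z. Pr (?A z))"
    using pmin_pos by simp
  also have "\<dots> \<le> (\<Sum>z\<in>?Z. Pr (?F z))"
    unfolding sum_distrib_left by (intro sum_mono step)
  also have "\<dots> \<le> Pr (\<lambda>\<omega>. x \<le> pos \<omega> 0 n \<and> (\<forall>t\<le>n. pos \<omega> 0 t < x + int L))"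
    by (rule Pr_disjoint[OF _ pF])
       (intro pred_intros_countable pred_intros_conj1' pred_intros_imp' pred_intros_logic pred_pos | auto)+
  finally show ?thesis .
qed

text \<open>
  A walk that is frozen at its first hit of \<open>[x, \<infinity>)\<close> never reaches \<open>x + L\<close>.
\<close>

lemma hit_prob_decay_step:
  assumes "0 \<le> x"
  shows "hit_prob n (x + int L) \<le> (1 - pmin) * hit_prob n x"
proof -
  let ?F = "\<lambda>\<omega>. x \<le> pos \<omega> 0 n \<and> (\<forall>t\<le>n. pos \<omega> 0 t < x + int L)"
  have pF: "Measurable.pred E ?F"
    by (intro pred_intros_countable pred_intros_conj1' pred_intros_imp' pred_intros_logic pred_pos)
  have "(\<Sum>b\<in>UNIV. Pr (if b then hits n (x + int L) else ?F)) \<le> Pr (hits n x)"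
  proof (rule Pr_disjoint[OF _ _ pred_hits])
    fix \<omega> b assume "(if b then hits n (x + int L) else ?F) \<omega>"
    then show "hits n x \<omega>"
      by (cases b) (force simp: hits_def)+
  next
    fix \<omega> b b' assume "(if b then hits n (x + int L) else ?F) \<omega>"
      "(if b' then hits n (x + int L) else ?F) \<omega>"
    moreover have "\<not> (hits n (x + int L) \<omega> \<and> ?F \<omega>)"
      unfolding hits_def by (meson not_le)
    ultimately show "b = b'" by (auto split: if_splits)
  qed (use pred_hits pF in \<open>auto split: if_splits\<close>)
  then have "hit_prob n (x + int L) + Pr ?F \<le> hit_prob n x"
    by (simp add: UNIV_bool hit_prob_def)
  with freeze[OF assms, of n] show ?thesis
    by (simp add: algebra_simps)
qed

lemma hit_prob_decay: "hit_prob n (int k * int L) \<le> (1 - pmin) ^ k"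
proof (induction k)
  case (Suc k)
  have "hit_prob n (int k * int L + int L) \<le> (1 - pmin) * hit_prob n (int k * int L)"
    by (rule hit_prob_decay_step) simp
  also have "\<dots> \<le> (1 - pmin) * (1 - pmin) ^ k"
    using Suc pmin_le_1 by (intro mult_left_mono) auto
  finally show ?case by (simp add: algebra_simps)
qed (simp add: hit_prob_le_1)

subsection \<open>Concatenation\<close>

text \<open>
  Decompose according to the site \<open>z\<close> at which \<open>[x, \<infinity>)\<close> is hit first.  The path up to this time
  depends on the sites below \<open>z\<close> only, and a climb from \<open>z\<close> depends on the sites from \<open>z\<close> on only.
\<close>

lemma climb_prob_supermult:
  assumes "0 \<le> x"
  shows "climb_prob n x * climb_prob m y \<le> climb_prob (n + m) (x + y)"
proof -
  let ?A = "\<lambda>z \<omega>. \<exists>t\<le>n. pos \<omega> 0 t = z \<and> (\<forall>j<t. 0 \<le> pos \<omega> 0 j \<and> pos \<omega> 0 j < x)"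
  let ?B = "\<lambda>z \<omega>. climbs m y (shift_env z \<omega>)"
  let ?Z = "{x..<x + int L}"
  have pA: "Measurable.pred E (?A z)" for z
    by (intro pred_intros_countable pred_intros_conj1' pred_intros_imp' pred_intros_logic pred_pos)
  have pB: "Measurable.pred E (?B z)" for z
    by (rule pred_compose[OF measurable_shift pred_climbs])
  have "climb_prob n x \<le> (\<Sum>z\<in>?Z. Pr (?A z))"
    unfolding climb_prob_def
  proof (rule Pr_union[OF _ pA])
    fix \<omega> assume \<omega>: "\<omega> \<in> envs L M" "climbs n x \<omega>"
    then obtain t where t: "t \<le> n" "x \<le> pos \<omega> 0 t" "\<forall>j\<le>t. 0 \<le> pos \<omega> 0 j"
      by (auto simp: climbs_def)
    obtain t0 where t0: "t0 \<le> t" "x \<le> pos \<omega> 0 t0" "\<And>j. j < t0 \<Longrightarrow> pos \<omega> 0 j < x"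
      using first_hit[OF t(2)] by blast
    with first_hit_range[OF \<omega>(1) L assms t0(2,3)] t(1,3)
    show "\<exists>z\<in>?Z. ?A z \<omega>" by (intro bexI[of _ "pos \<omega> 0 t0"] exI[of _ t0]) auto
  qed simp
  then have "climb_prob n x * climb_prob m y \<le> (\<Sum>z\<in>?Z. Pr (?A z) * climb_prob m y)"
    unfolding sum_distrib_right[symmetric] by (rule mult_right_mono) (rule climb_prob_nonneg)
  also have "\<dots> = (\<Sum>z\<in>?Z. Pr (\<lambda>\<omega>. ?A z \<omega> \<and> ?B z \<omega>))"
  proof (rule sum.cong[OF refl])
    fix z assume z: "z \<in> ?Z"
    have "Pr (\<lambda>\<omega>. ?A z \<omega> \<and> ?B z \<omega>) = Pr (?A z) * Pr (?B z)"
    proof (rule Pr_indep[OF pA pB, where A = "{..<z}" and B = "{z..}"])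
      fix \<omega> \<omega>' :: env
      assume eq: "\<And>j w. w \<in> {..<z} \<Longrightarrow> \<omega> (j, w) = \<omega>' (j, w)" and "?A z \<omega>"
      then obtain t where t: "t \<le> n" "pos \<omega> 0 t = z" "\<forall>j<t. 0 \<le> pos \<omega> 0 j \<and> pos \<omega> 0 j < x"
        by blast
      have "pos \<omega>' 0 i = pos \<omega> 0 i" if "i \<le> t" for i
        by (rule pos_agree[OF _ that], rule eq[symmetric]) (use t z in force)
      with t show "?A z \<omega>'"
        by (intro exI[of _ t]) auto
    next
      fix \<omega> \<omega>' :: env
      assume eq: "\<And>j w. w \<in> {z..} \<Longrightarrow> \<omega> (j, w) = \<omega>' (j, w)" and "?B z \<omega>"
      then obtain t where t: "t \<le> m" "y \<le> pos (shift_env z \<omega>) 0 t"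
          "\<forall>j\<le>t. 0 \<le> pos (shift_env z \<omega>) 0 j"
        by (auto simp: climbs_def)
      have "pos (shift_env z \<omega>') 0 i = pos (shift_env z \<omega>) 0 i" if "i \<le> t" for i
      proof (rule pos_agree[OF _ that])
        fix j k assume "j < t"
        with t(3) have "0 \<le> pos (shift_env z \<omega>) 0 j" by simp
        then show "shift_env z \<omega>' (k, pos (shift_env z \<omega>) 0 j) = shift_env z \<omega> (k, pos (shift_env z \<omega>) 0 j)"
          using eq[of "pos (shift_env z \<omega>) 0 j + z" k] by (simp add: shift_env_def)
      qed
      with t show "?B z \<omega>'"
        unfolding climbs_def by (intro exI[of _ t]) auto
    qed auto
    also have "Pr (?B z) = climb_prob m y"
      unfolding climb_prob_def by (rule Pr_shift[OF pred_climbs])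
    finally show "Pr (?A z) * climb_prob m y = Pr (\<lambda>\<omega>. ?A z \<omega> \<and> ?B z \<omega>)" ..
  qed
  also have "\<dots> \<le> climb_prob (n + m) (x + y)"
    unfolding climb_prob_def
  proof (rule Pr_disjoint[OF _ _ pred_climbs])
    fix z show "Measurable.pred E (\<lambda>\<omega>. ?A z \<omega> \<and> ?B z \<omega>)"
      by (intro pred_intros_logic pA pB)
  next
    fix \<omega> z assume "\<omega> \<in> envs L M" "z \<in> ?Z" "?A z \<omega> \<and> ?B z \<omega>"
    then obtain t i where t: "t \<le> n" "pos \<omega> 0 t = z" "\<forall>j<t. 0 \<le> pos \<omega> 0 j \<and> pos \<omega> 0 j < x"
      and i: "i \<le> m" "y \<le> pos (shift_env z \<omega>) 0 i" "\<forall>j\<le>i. 0 \<le> pos (shift_env z \<omega>) 0 j" and z: "x \<le> z"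
      by (auto simp: climbs_def)
    have join: "pos \<omega> 0 (t + j) = z + pos (shift_env z \<omega>) 0 j" if "j \<le> i" for j
    proof -
      have "pos \<omega> 0 (t + j) = pos \<omega> z j"
      proof (rule pos_restart[OF t(2)])
        show "pos \<omega> 0 k < z" if "k < t" for k using t(3) that z by force
        show "z \<le> pos \<omega> z k" if "k < j" for k
          using i(3) that \<open>j \<le> i\<close> by (subst pos_shift) simp
      qed
      then show ?thesis by (simp add: pos_shift[of \<omega> z])
    qed
    have "0 \<le> pos \<omega> 0 k" if "k \<le> t + i" for k
    proof (cases "k < t")
      case False
      with join[of "k - t"] i(3) that z assms show ?thesis by simp
    qed (use t(3) in simp)
    with join[of i] i(1,2) t(1) z show "climbs (n + m) (x + y) \<omega>"
      unfolding climbs_def by (intro exI[of _ "t + i"]) simp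
  next
    fix \<omega> z z' assume z: "z \<in> ?Z" "z' \<in> ?Z" and "?A z \<omega> \<and> ?B z \<omega>" "?A z' \<omega> \<and> ?B z' \<omega>"
    then obtain t t' where t: "pos \<omega> 0 t = z" "\<forall>j<t. pos \<omega> 0 j < x"
      "pos \<omega> 0 t' = z'" "\<forall>j<t'. pos \<omega> 0 j < x"
      by auto
    then have "\<not> t < t'" "\<not> t' < t" using z by force+
    then show "z = z'" using t by auto
  qed simp
  finally show ?thesis .
qed

lemma climb_prob_full_speed: "pmin ^ n \<le> climb_prob n (int L * int n)"
proof (induction n)
  case 0
  have "climb_prob 0 0 = Pr (\<lambda>_. True)"
    unfolding climb_prob_def by (rule Pr_cong) (simp add: climbs_def)
  then show ?case by (simp add: Pr_True)
next
  case (Suc n)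
  have one: "pmin \<le> climb_prob 1 (int L)"
  proof -
    have G: "(\<lambda>_. int L) \<in> envs L M" by (rule envsI) auto
    have "cmin ^ (M * card {0 :: int}) * Pr (\<lambda>\<omega>. climbs 1 (int L) (override {0} (\<lambda>_. int L) \<omega>)) \<le> climb_prob 1 (int L)"
      unfolding climb_prob_def by (rule Pr_override[OF _ G pred_climbs]) simp
    moreover have "climbs 1 (int L) (override {0} (\<lambda>_. int L) \<omega>)" for \<omega>
      unfolding climbs_def by (intro exI[of _ 1]) (auto simp: pos_Suc override_def le_Suc_eq)
    ultimately show ?thesis by (simp add: Pr_True pmin_def)
  qed
  have "pmin ^ Suc n \<le> climb_prob n (int L * int n) * climb_prob 1 (int L)"
    using mult_mono[OF Suc one] pmin_pos climb_prob_nonneg[of n] by (simp add: mult.commute)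
  also have "\<dots> \<le> climb_prob (n + 1) (int L * int n + int L)"
    by (rule climb_prob_supermult) simp
  finally show ?case by (simp add: algebra_simps)
qed

subsection \<open>Hitting costs hardly more than climbing\<close>

text \<open>
  The gadgets on a set of sites.  Fixing the values elsewhere leaves finitely many of them, in a
  number that depends on the size of the set alone.
\<close>

definition patterns :: "int set \<Rightarrow> env set" where
  "patterns Z = {G \<in> envs L M. \<forall>j z. z \<notin> Z \<longrightarrow> G (j, z) = 0}"

lemma card_patterns:
  assumes "finite Z"
  shows "finite (patterns Z)" "card (patterns Z) \<le> (2 * L + 1) ^ (M * card Z)"
proof -
  let ?I = "{..<M} \<times> Z"
  let ?T = "PiE ?I (\<lambda>_. {- int L..int L})"
  have fT: "finite ?T"
    using assms by (intro finite_PiE) auto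
  have inj: "inj_on (\<lambda>G. restrict G ?I) (patterns Z)"
  proof (rule inj_onI, rule ext)
    fix G G' :: env and i :: "nat \<times> int"
    assume G: "G \<in> patterns Z" "G' \<in> patterns Z" "restrict G ?I = restrict G' ?I"
    obtain j z where i: "i = (j, z)" by (cases i)
    have tail: "G (j, z) = G (min j (M - 1), z)" "G' (j, z) = G' (min j (M - 1), z)"
      using G(1,2) envs_tail[of _ L M j z] by (auto simp: patterns_def min_def)
    show "G i = G' i"
    proof (cases "z \<in> Z")
      case True
      then have "(min j (M - 1), z) \<in> ?I" using M by auto
      then show ?thesis
        using fun_cong[OF G(3), of "(min j (M - 1), z)"] tail i by simp
    qed (use G(1,2) i in \<open>simp add: patterns_def\<close>)
  qed
  have "(\<lambda>G. restrict G ?I) ` patterns Z \<subseteq> ?T"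
  proof
    fix f assume "f \<in> (\<lambda>G. restrict G ?I) ` patterns Z"
    then obtain G where "G \<in> envs L M" "f = restrict G ?I" by (auto simp: patterns_def)
    then show "f \<in> ?T"
      by (auto simp: envs_def)
  qed
  moreover have "nat (2 * int L + 1) = 2 * L + 1" by simp
  ultimately show "finite (patterns Z)" "card (patterns Z) \<le> (2 * L + 1) ^ (M * card Z)"
    using inj_on_finite[OF inj _ fT] card_inj_on_le[OF inj _ fT] assms
    by (auto simp: card_PiE card_cartesian_product prod_constant)
qed

definition width :: "nat \<Rightarrow> nat" where "width K = (K + 2) * L"
definition delay :: "nat \<Rightarrow> nat" where "delay K = (2 * K + 6) * (K + 1)"

text \<open>
  The number of starting points in a window times the number of gadgets, divided by a lower bound for
  the probability of a single gadget.
\<close>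

definition cost :: "nat \<Rightarrow> real" where
  "cost K = real (width K) * real (2 * L + 1) ^ (M * width K) / cmin ^ (M * width K)"

lemma cost_pos: "0 < cost K"
proof -
  have "0 < width K" using L by (simp add: width_def)
  then show ?thesis
    unfolding cost_def using cmin_pos by (intro divide_pos_pos mult_pos_pos zero_less_power) auto
qed

text \<open>
  A union bound over the level \<open>y = i L\<close> with \<open>1 \<le> i \<le> N\<close>, the starting point of the reflected walk and
  the gadget.  Since the \<open>N\<close> strips are disjoint, one of them is visited at most \<open>n / N \<le> K\<close> times.
  The reflected walk performs a climb from its starting point, which lies below \<open>N L\<close>.
\<close>

lemma hit_prob_le_climb_prob:
  assumes "int N * int L \<le> x" and "n \<le> K * N" and "N \<ge> 1"
  shows "hit_prob n x \<le> real N * cost K * climb_prob (n + delay K) (x - int N * int L)"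
proof -
  let ?D = "width K" and ?n = "n + delay K"
  define lev where "lev i = int i * int L" for i :: nat
  define Z where "Z i = {lev i - int ?D..<lev i}" for i
  define W where "W s \<omega> \<longleftrightarrow> (\<exists>t\<le>?n. x \<le> pos \<omega> s t \<and> (\<forall>j\<le>t. s \<le> pos \<omega> s j))" for s \<omega>
  define I where "I = (SIGMA i:{1..N}. {1..?D} \<times> patterns (Z i))"
  define Q where "Q = (\<lambda>(i, r, G) \<omega>. W (lev i - int r) (override (Z i) G \<omega>))"
  let ?b = "climb_prob ?n (x - int N * int L) / cmin ^ (M * ?D)"
  have fZ: "finite (Z i)" "card (Z i) = ?D" for i
    by (auto simp: Z_def)
  have W_eq: "W s \<omega> \<longleftrightarrow> climbs ?n (x - s) (shift_env s \<omega>)" for s \<omega>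
    unfolding W_def climbs_def by (subst (1 2) pos_shift) (simp add: algebra_simps)
  have pW: "Measurable.pred E (W s)" for s
    unfolding W_eq by (rule pred_compose[OF measurable_shift pred_climbs])
  have PW: "Pr (W (lev i - int r)) \<le> climb_prob ?n (x - int N * int L)" if "i \<le> N" for i r
  proof -
    have "Pr (W (lev i - int r)) = climb_prob ?n (x - (lev i - int r))"
      unfolding W_eq climb_prob_def by (rule Pr_shift[OF pred_climbs])
    also have "int i * int L \<le> int N * int L"
      using that by (intro mult_right_mono) auto
    then have "climb_prob ?n (x - (lev i - int r)) \<le> climb_prob ?n (x - int N * int L)"
      by (intro climb_prob_mono) (auto simp: lev_def)
    finally show ?thesis .
  qed
  have Gin: "G \<in> envs L M" if "G \<in> patterns Z'" for G Z'
    using that by (simp add: patterns_def)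
  have pQ: "Measurable.pred E (Q a)" if "a \<in> I" for a
    using that unfolding Q_def I_def
    by (auto intro!: pred_compose[OF measurable_override pW] intro: Gin)
  have PQ: "Pr (Q a) \<le> ?b" if a: "a \<in> I" for a
  proof -
    obtain i r G where irG: "a = (i, r, G)" "i \<le> N" "G \<in> patterns (Z i)"
      using a unfolding I_def by auto
    have "cmin ^ (M * card (Z i)) * Pr (Q a) \<le> Pr (W (lev i - int r))"
      unfolding Q_def irG(1) prod.case
      by (rule Pr_override[OF fZ(1) Gin[OF irG(3)] pW])
    also have "\<dots> \<le> climb_prob ?n (x - int N * int L)"
      by (rule PW[OF irG(2)])
    finally show ?thesis
      using cmin_pos by (simp add: fZ(2) field_simps)
  qed
  have fI: "finite I"
    unfolding I_def using card_patterns(1)[OF fZ(1)] by auto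
  have cI: "card I \<le> N * (?D * (2 * L + 1) ^ (M * ?D))"
  proof -
    have "card I = (\<Sum>i\<in>{1..N}. ?D * card (patterns (Z i)))"
      unfolding I_def using card_patterns(1)[OF fZ(1)]
      by (subst card_SigmaI) (auto simp: card_cartesian_product)
    also have "\<dots> \<le> (\<Sum>i\<in>{1..N}. ?D * (2 * L + 1) ^ (M * ?D))"
      using card_patterns(2)[OF fZ(1)] by (intro sum_mono mult_left_mono) (auto simp: fZ(2))
    finally show ?thesis by simp
  qed
  have "hit_prob n x \<le> (\<Sum>a\<in>I. Pr (Q a))"
    unfolding hit_prob_def
  proof (rule Pr_union[OF fI pQ])
    fix \<omega> assume \<omega>: "\<omega> \<in> envs L M" "hits n x \<omega>"
    then obtain t where t: "t \<le> n" "x \<le> pos \<omega> 0 t" by (auto simp: hits_def)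
    have "\<exists>i\<in>{1..N}. strip_visits \<omega> L (lev i) t \<le> K"
    proof (rule ccontr)
      assume "\<not> ?thesis"
      then have "(\<Sum>i\<in>{1..N}. Suc K) \<le> (\<Sum>i\<in>{1..N}. strip_visits \<omega> L (lev i) t)"
        by (intro sum_mono) (auto simp: not_le Suc_le_eq)
      also have "\<dots> = (\<Sum>z\<in>(\<Union>i\<in>{1..N}. {lev i - int L..<lev i}). cnt \<omega> 0 t z)"
        unfolding strip_visits_def
      proof (rule sum.UNION_disjoint[symmetric])
        have "{lev i - int L..<lev i} \<inter> {lev j - int L..<lev j} = {}" if "i < j" for i j
        proof -
          have "(int i + 1) * int L \<le> int j * int L"
            using that by (intro mult_right_mono) auto
          then have "lev i \<le> lev j - int L"
            by (simp add: lev_def algebra_simps)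
          then show ?thesis by auto
        qed
        then show "\<forall>i\<in>{1..N}. \<forall>j\<in>{1..N}. i \<noteq> j \<longrightarrow>
            {lev i - int L..<lev i} \<inter> {lev j - int L..<lev j} = {}"
          by (metis inf_commute linorder_neqE_nat)
      qed auto
      also have "\<dots> \<le> t"
        by (rule sum_cnt_le) auto
      finally show False
        using t(1) assms(2,3) by (simp add: algebra_simps)
    qed
    then obtain i where i: "1 \<le> i" "i \<le> N" "strip_visits \<omega> L (lev i) t \<le> K" by auto
    have "1 * int L \<le> int i * int L" "int i * int L \<le> int N * int L"
      using i by (intro mult_right_mono; simp)+
    then have y: "0 < lev i" "lev i \<le> pos \<omega> 0 t"
      using L t(2) assms(1) unfolding lev_def by linarith+
    have D: "int (K + 2) * int L = int ?D"
      by (simp add: width_def algebra_simps)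
    obtain \<omega>' s t' where \<omega>': "\<omega>' \<in> envs L M"
      "\<And>j z. z \<ge> lev i \<or> z < lev i - int ?D \<Longrightarrow> \<omega>' (j, z) = \<omega> (j, z)"
      "lev i - int ?D \<le> s" "s < lev i" "t' \<le> t + delay K"
      "pos \<omega>' s t' = pos \<omega> 0 t" "\<And>j. j \<le> t' \<Longrightarrow> s \<le> pos \<omega>' s j"
    proof (rule reflection[OF \<omega>(1) L M y i(3), unfolded D, folded delay_def])
      fix \<omega>' s t'
      assume a: "\<omega>' \<in> envs L M"
        "\<And>j z. z \<ge> lev i \<or> z < lev i - int ?D \<Longrightarrow> \<omega>' (j, z) = \<omega> (j, z)"
        "lev i - int ?D \<le> s" "s < lev i" "t' \<le> t + delay K"
        "pos \<omega>' s t' = pos \<omega> 0 t" "\<And>j. j \<le> t' \<Longrightarrow> s \<le> pos \<omega>' s j"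
      show thesis by (rule that[OF a])
    qed
    define G where "G = (\<lambda>(j, z). if z \<in> Z i then \<omega>' (j, z) else 0)"
    have "G \<in> envs L M"
    proof (rule envsI)
      show "\<bar>G (j, z)\<bar> \<le> int L" for j z
        using envs_range[OF \<omega>'(1), of j z] by (simp add: G_def)
      show "G (j, z) = G (M - 1, z)" if "j \<ge> M - 1" for j z
        using envs_tail[OF \<omega>'(1) that, of z] by (simp add: G_def)
    qed
    then have G: "G \<in> patterns (Z i)"
      by (auto simp: patterns_def G_def)
    have over: "override (Z i) G \<omega> = \<omega>'"
      using \<omega>'(2) by (auto simp: override_def G_def Z_def fun_eq_iff not_le not_less)
    have "W s \<omega>'"
      unfolding W_def using \<omega>'(5-7) t by (intro exI[of _ t']) auto
    then have "Q (i, nat (lev i - s), G) \<omega>"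
      using \<omega>'(4) by (simp add: Q_def over)
    moreover have "(i, nat (lev i - s), G) \<in> I"
      using i G \<omega>'(3,4) by (auto simp: I_def)
    ultimately show "\<exists>a\<in>I. Q a \<omega>" by blast
  qed
  also have "\<dots> \<le> real (card I) * ?b"
    using sum_bounded_above[of I "\<lambda>a. Pr (Q a)" ?b] PQ by simp
  also have "\<dots> \<le> real (N * (?D * (2 * L + 1) ^ (M * ?D))) * ?b"
    using cI cmin_pos climb_prob_nonneg by (intro mult_right_mono) (auto simp del: of_nat_mult)
  also have "\<dots> = real N * cost K * climb_prob ?n (x - int N * int L)"
    by (simp add: cost_def)
  finally show ?thesis .
qed

subsection \<open>Extreme speeds\<close>

lemma hit_prob_eq_0: "int L * int n < x \<Longrightarrow> hit_prob n x = 0"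
proof -
  assume x: "int L * int n < x"
  have "\<not> hits n x \<omega>" if "\<omega> \<in> envs L M" for \<omega>
  proof
    assume "hits n x \<omega>"
    then obtain t where "t \<le> n" "x \<le> pos \<omega> 0 t" by (auto simp: hits_def)
    moreover have "pos \<omega> 0 t \<le> int L * int t"
      using pos_bound[OF that, of 0 t] by simp
    moreover have "int L * int t \<le> int L * int n"
      using \<open>t \<le> n\<close> by (intro mult_left_mono) auto
    ultimately show False using x by linarith
  qed
  then have "{\<omega> \<in> envs L M. hits n x \<omega>} = {}" by blast
  then show ?thesis unfolding hit_prob_def Pr_def by (simp only: measure_empty)
qed

text \<open>
  At full speed all jumps have to be \<open>L\<close>, so hitting and climbing are the same event.
\<close>

lemma hit_prob_full_speed: "hit_prob n (int L * int n) \<le> climb_prob n (int L * int n)"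
  unfolding hit_prob_def climb_prob_def
proof (rule Pr_mono[OF pred_climbs])
  fix \<omega> assume \<omega>: "\<omega> \<in> envs L M" "hits n (int L * int n) \<omega>"
  then obtain t where t: "t \<le> n" "int L * int n \<le> pos \<omega> 0 t" by (auto simp: hits_def)
  have "0 \<le> pos \<omega> 0 j" if "j \<le> t" for j
  proof -
    have "pos \<omega> 0 t \<le> pos \<omega> 0 j + int L * int (t - j)"
      by (rule pos_advance[OF \<omega>(1) that])
    moreover have "int L * int (t - j) \<le> int L * int n"
      using t(1) by (intro mult_left_mono) auto
    ultimately show ?thesis using t(2) by linarith
  qed
  with t show "climbs n (int L * int n) \<omega>"
    unfolding climbs_def by blast
qed

lemma tail_prob_eq: "tail_prob L M \<mu> x n = Pr (\<lambda>\<omega>. \<lceil>x\<rceil> \<le> pos \<omega> 0 n)"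
  unfolding tail_prob_def Pr_def walk_eq_pos by (simp add: ceiling_le_iff)

lemma tail_prob_le: "tail_prob L M \<mu> x n \<le> hit_prob n \<lceil>x\<rceil>"
  unfolding tail_prob_eq hit_prob_def by (rule Pr_mono) (auto simp: hits_def)

lemma tail_prob_ge: "0 \<le> x \<Longrightarrow> pmin * hit_prob n \<lceil>x\<rceil> \<le> tail_prob L M \<mu> x n"
  unfolding tail_prob_eq
  by (rule order_trans[OF freeze Pr_mono]) (auto intro: pred_pos)

end

section \<open>The rate function\<close>

text \<open>
  Fekete's lemma.  As \<open>a\<close> is nonpositive, rounding \<open>n\<close> down to a multiple of \<open>k\<close> does not decrease
  the contribution of the blocks of length \<open>k\<close>; the linear lower bound controls the remainder.
\<close>

lemma superadditive_limit:
  fixes a :: "nat \<Rightarrow> real"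
  assumes super: "\<And>m n. a m + a n \<le> a (m + n)"
    and upper: "\<And>n. a n \<le> 0" and lower: "\<And>n. - (c * real n) \<le> a n" and c: "0 \<le> c"
  obtains l where "(\<lambda>n. a n / real n) \<longlonglongrightarrow> l" "\<And>n. a n \<le> l * real n" "l \<le> 0"
proof
  define l where "l = (SUP n\<in>{1..}. a n / real n)"
  have bdd: "bdd_above ((\<lambda>n. a n / real n) ` {1..})"
    by (rule bdd_aboveI[of _ 0]) (auto intro: divide_nonpos_nonneg upper)
  have le: "a n / real n \<le> l" if "n \<ge> 1" for n
    unfolding l_def by (rule cSUP_upper[OF _ bdd]) (use that in simp)
  show "a n \<le> l * real n" for n
    using le[of n] upper[of 0] by (cases "n = 0") (simp_all add: field_simps)
  show "l \<le> 0"
    unfolding l_def by (rule cSUP_least) (auto intro: divide_nonpos_nonneg upper)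
  have mult: "real q * a k \<le> a (q * k)" for q k
  proof (induction q)
    case (Suc q)
    then show ?case using super[of k "q * k"] by (simp add: algebra_simps)
  qed (use lower[of 0] in simp)
  show "(\<lambda>n. a n / real n) \<longlonglongrightarrow> l"
  proof (rule LIMSEQ_I)
    fix e :: real assume e: "0 < e"
    have "\<exists>x\<in>(\<lambda>n. a n / real n) ` {1..}. l - e / 2 < x"
      using less_cSUP_iff[OF _ bdd, of "l - e / 2"] e unfolding l_def by fastforce
    then obtain k where k: "k \<ge> 1" "l - e / 2 < a k / real k" by auto
    obtain n0 where n0: "real n0 > c * real k / (e / 2)"
      using reals_Archimedean2 by blast
    have "norm (a n / real n - l) < e" if n: "n \<ge> max 1 n0" for n
    proof -
      have "a n = a ((n div k) * k + n mod k)" by simp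
      then have "real (n div k) * a k + a (n mod k) \<le> a n"
        using super[of "(n div k) * k" "n mod k"] mult[of "n div k" k] by simp
      moreover have "real n / real k * a k \<le> real (n div k) * a k"
        using upper[of k] of_nat_div_le_of_nat[of n k] by (rule mult_right_mono_neg[rotated])
      moreover have "- (c * real k) \<le> a (n mod k)"
      proof -
        have "c * real (n mod k) \<le> c * real k"
          using k(1) c by (intro mult_left_mono) (auto intro: less_imp_le)
        with lower[of "n mod k"] show ?thesis by linarith
      qed
      ultimately have "real n / real k * a k - c * real k \<le> a n" by linarith
      then have "(real n / real k * a k - c * real k) / real n \<le> a n / real n"
        by (rule divide_right_mono) simp
      then have "a k / real k - c * real k / real n \<le> a n / real n"
        using n by (simp add: diff_divide_distrib)
      moreover have "c * real k / real n < e / 2"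
      proof -
        have "real n0 \<le> real n" using n by simp
        with n0 have "c * real k / (e / 2) < real n" by linarith
        then show ?thesis using e n by (simp add: field_simps)
      qed
      moreover have "a n / real n \<le> l" using n by (intro le) simp
      ultimately show ?thesis using k(2) by (simp add: abs_if)
    qed
    then show "\<exists>no. \<forall>n\<ge>no. norm (a n / real n - l) < e" by blast
  qed
qed

context cookie_walk
begin

definition log_climb :: "real \<Rightarrow> nat \<Rightarrow> real" where "log_climb v n = ln (climb_prob n \<lceil>v * real n\<rceil>)"
definition log_hit :: "real \<Rightarrow> nat \<Rightarrow> real" where "log_hit v n = ln (hit_prob n \<lceil>v * real n\<rceil>)"
definition climb_rate :: "real \<Rightarrow> real" where "climb_rate v = lim (\<lambda>n. log_climb v n / real n)"

lemma climb_prob_ge: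
  assumes "v \<le> real L"
  shows "pmin ^ n \<le> climb_prob n \<lceil>v * real n\<rceil>"
proof -
  have "v * real n \<le> real_of_int (int L * int n)"
    using assms by (simp add: mult_right_mono)
  then have "\<lceil>v * real n\<rceil> \<le> int L * int n"
    by (simp only: ceiling_le_iff)
  then show ?thesis
    using climb_prob_full_speed[of n] climb_prob_mono[of n n "\<lceil>v * real n\<rceil>" "int L * int n"] by simp
qed

lemma climb_prob_pos: "v \<le> real L \<Longrightarrow> 0 < climb_prob n \<lceil>v * real n\<rceil>"
  using climb_prob_ge[of v n] pmin_pos by (meson less_le_trans zero_less_power)

lemma hit_prob_pos: "v \<le> real L \<Longrightarrow> 0 < hit_prob n \<lceil>v * real n\<rceil>"
  using climb_prob_pos climb_prob_le_hit_prob by (meson less_le_trans)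

lemma log_climb_le_log_hit: "v \<le> real L \<Longrightarrow> log_climb v n \<le> log_hit v n"
  unfolding log_climb_def log_hit_def using climb_prob_pos[of v n] climb_prob_le_hit_prob[of n] by (intro ln_mono) auto

lemma log_climb_superadditive:
  assumes "0 < u" "u \<le> real L" "0 < v" "v \<le> real L" "w * real (m + n) \<le> u * real m + v * real n"
  shows "log_climb u m + log_climb v n \<le> log_climb w (m + n)"
proof -
  have "w * real (m + n) \<le> real_of_int (\<lceil>u * real m\<rceil> + \<lceil>v * real n\<rceil>)"
    using assms(5) le_of_int_ceiling[of "u * real m"] le_of_int_ceiling[of "v * real n"]
    unfolding of_int_add by linarith
  then have "\<lceil>w * real (m + n)\<rceil> \<le> \<lceil>u * real m\<rceil> + \<lceil>v * real n\<rceil>"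
    by (simp only: ceiling_le_iff)
  then have "climb_prob (m + n) (\<lceil>u * real m\<rceil> + \<lceil>v * real n\<rceil>) \<le> climb_prob (m + n) \<lceil>w * real (m + n)\<rceil>"
    by (intro climb_prob_mono) auto
  moreover have "climb_prob m \<lceil>u * real m\<rceil> * climb_prob n \<lceil>v * real n\<rceil> \<le> climb_prob (m + n) (\<lceil>u * real m\<rceil> + \<lceil>v * real n\<rceil>)"
    using assms(1) by (intro climb_prob_supermult) (simp add: le_ceiling_iff less_le_trans[of "-1" 0])
  ultimately have "ln (climb_prob m \<lceil>u * real m\<rceil> * climb_prob n \<lceil>v * real n\<rceil>) \<le> log_climb w (m + n)"
    unfolding log_climb_def using climb_prob_pos[OF assms(2), of m] climb_prob_pos[OF assms(4), of n]
    by (intro ln_mono) auto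
  then show ?thesis
    using climb_prob_pos[OF assms(2), of m] climb_prob_pos[OF assms(4), of n] by (simp add: log_climb_def ln_mult)
qed

lemma climb_rate:
  assumes "0 < v" "v \<le> real L"
  shows "(\<lambda>n. log_climb v n / real n) \<longlonglongrightarrow> climb_rate v" "log_climb v n \<le> climb_rate v * real n" "climb_rate v \<le> 0"
proof -
  have super: "log_climb v m + log_climb v n \<le> log_climb v (m + n)" for m n
    by (rule log_climb_superadditive) (use assms in \<open>auto simp: algebra_simps\<close>)
  have upper: "log_climb v n \<le> 0" for n
    unfolding log_climb_def using climb_prob_pos[OF assms(2), of n] climb_prob_le_hit_prob[of n] hit_prob_le_1[of n]
    by (meson ln_le_zero_iff order_trans)
  have lower: "- (- ln pmin * real n) \<le> log_climb v n" for n
  proof -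
    have "ln (pmin ^ n) \<le> log_climb v n"
      unfolding log_climb_def using climb_prob_ge[OF assms(2), of n] pmin_pos by (intro ln_mono) (auto simp: climb_prob_pos assms)
    then show ?thesis using pmin_pos by (simp add: ln_realpow mult.commute)
  qed
  obtain l where l: "(\<lambda>n. log_climb v n / real n) \<longlonglongrightarrow> l" "\<And>n. log_climb v n \<le> l * real n" "l \<le> 0"
    using superadditive_limit[OF super upper lower] pmin_pos pmin_le_1 by auto
  moreover have "climb_rate v = l"
    unfolding climb_rate_def using l(1) by (rule limI)
  ultimately show "(\<lambda>n. log_climb v n / real n) \<longlonglongrightarrow> climb_rate v" "log_climb v n \<le> climb_rate v * real n" "climb_rate v \<le> 0"
    by auto
qed

text \<open>
  With \<open>N = \<lfloor>\<eta> n\<rfloor>\<close> levels the distance \<open>N L\<close> is lost.  It is regained by \<open>m\<close> steps at full speed, where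
  \<open>m\<close> is chosen such that the speed over the total time \<open>n + delay K + m\<close> is again at least \<open>v\<close>; this
  is possible because \<open>v < L\<close>, and \<open>m\<close> is proportional to \<open>\<eta> n\<close> up to a constant.
\<close>

lemma log_hit_upper:
  assumes v: "0 < v" "v < real L" and eta: "0 < \<eta>" "\<eta> \<le> 1" "\<eta> * real L \<le> v" and n: "2 \<le> \<eta> * real n"
  defines "K \<equiv> nat \<lceil>2 / \<eta>\<rceil>"
  shows "log_hit v n \<le> ln (real n) + ln (cost K) +
      - ln pmin * ((\<eta> * real L * real n + v * real (delay K)) / (real L - v) + 1) + climb_rate v * real n"
proof -
  define N where "N = nat \<lfloor>\<eta> * real n\<rfloor>"
  define c where "c = delay K"
  define q where "q = (\<eta> * real L * real n + v * real c) / (real L - v)"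
  define m where "m = nat \<lceil>q\<rceil>"
  define n' where "n' = n + c + m"
  let ?x = "\<lceil>v * real n\<rceil>"
  have q: "0 \<le> q"
    unfolding q_def using v eta by (intro divide_nonneg_pos add_nonneg_nonneg) auto
  have m: "q \<le> real m" "real m \<le> q + 1"
    unfolding m_def using q by linarith+
  have N: "real N \<le> \<eta> * real n" "\<eta> * real n / 2 \<le> real N" "1 \<le> N"
    unfolding N_def using n by linarith+
  have NL: "real N * real L \<le> v * real n"
  proof -
    have "real N * real L \<le> \<eta> * real n * real L"
      using N(1) by (intro mult_right_mono) auto
    also have "\<dots> = (\<eta> * real L) * real n" by simp
    also have "\<dots> \<le> v * real n"
      using eta(3) by (intro mult_right_mono) auto
    finally show ?thesis .
  qed
  then have NLx: "int N * int L \<le> ?x"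
    by (simp add: le_ceiling_iff)
  have "real n \<le> real (K * N)"
  proof -
    have "2 / \<eta> \<le> real K" unfolding K_def by linarith
    then have "2 / \<eta> * (\<eta> * real n / 2) \<le> real K * real N"
      using N(2) n by (intro mult_mono) auto
    then show ?thesis using eta(1) by simp
  qed
  then have KN: "n \<le> K * N" by linarith
  have "v * real n' \<le> v * real n - real N * real L + real L * real m"
  proof -
    have "q * (real L - v) \<le> real m * (real L - v)"
      using m(1) v by (intro mult_right_mono) auto
    moreover have "q * (real L - v) = \<eta> * real L * real n + v * real c"
      using v by (simp add: q_def)
    moreover have "real N * real L \<le> \<eta> * real n * real L"
      using N(1) by (intro mult_right_mono) auto
    ultimately show ?thesis
      by (simp add: n'_def algebra_simps)
  qed
  then have "v * real n' \<le> real_of_int (?x - int N * int L + int L * int m)"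
    using le_of_int_ceiling[of "v * real n"]
    unfolding of_int_add of_int_diff of_int_mult of_int_of_nat_eq by linarith
  then have x': "\<lceil>v * real n'\<rceil> \<le> ?x - int N * int L + int L * int m"
    by (simp only: ceiling_le_iff)
  have "climb_prob (n + c) (?x - int N * int L) * pmin ^ m \<le>
      climb_prob (n + c) (?x - int N * int L) * climb_prob m (int L * int m)"
    by (intro mult_left_mono climb_prob_full_speed climb_prob_nonneg)
  also have "\<dots> \<le> climb_prob n' (?x - int N * int L + int L * int m)"
    unfolding n'_def using NLx by (intro climb_prob_supermult) simp
  also have "\<dots> \<le> climb_prob n' \<lceil>v * real n'\<rceil>"
    by (intro climb_prob_mono x') simp
  also have "\<dots> = exp (log_climb v n')"
    using climb_prob_pos[of v n'] v by (simp add: log_climb_def)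
  also have "\<dots> \<le> exp (climb_rate v * real n)"
  proof -
    have "climb_rate v * real n' \<le> climb_rate v * real n"
      using climb_rate(3)[of v] v by (intro mult_left_mono_neg) (auto simp: n'_def)
    with climb_rate(2)[of v n'] v show ?thesis by simp
  qed
  finally have climb_prob_le: "climb_prob (n + c) (?x - int N * int L) \<le> exp (climb_rate v * real n) / pmin ^ m"
    using pmin_pos by (simp add: field_simps)
  have "hit_prob n ?x \<le> real N * cost K * climb_prob (n + c) (?x - int N * int L)"
    unfolding c_def by (rule hit_prob_le_climb_prob[OF NLx KN N(3)])
  also have "\<dots> \<le> real N * cost K * (exp (climb_rate v * real n) / pmin ^ m)"
    using cost_pos[of K] by (intro mult_left_mono climb_prob_le) auto
  finally have "log_hit v n \<le> ln (real N * cost K * (exp (climb_rate v * real n) / pmin ^ m))"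
    unfolding log_hit_def using hit_prob_pos[of v n] v by (intro ln_mono) auto
  also have "\<dots> = ln (real N) + ln (cost K) + climb_rate v * real n - real m * ln pmin"
    using cost_pos[of K] N(3) pmin_pos by (simp add: ln_mult ln_div ln_realpow)
  also have "\<dots> \<le> ln (real n) + ln (cost K) + climb_rate v * real n + - ln pmin * (q + 1)"
  proof -
    have "\<eta> * real n \<le> 1 * real n"
      using eta by (intro mult_right_mono) auto
    then have "ln (real N) \<le> ln (real n)"
      using N by (intro ln_mono) auto
    moreover have "- ln pmin * real m \<le> - ln pmin * (q + 1)"
      using m(2) pmin_pos pmin_le_1 by (intro mult_left_mono) auto
    ultimately show ?thesis by (simp add: algebra_simps)
  qed
  finally show ?thesis
    by (simp add: q_def c_def)
qed

lemma log_hit_limit: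
  assumes v: "0 < v" "v \<le> real L"
  shows "(\<lambda>n. log_hit v n / real n) \<longlonglongrightarrow> climb_rate v"
proof (rule order_tendstoI)
  fix a assume "a < climb_rate v"
  then have "eventually (\<lambda>n. a < log_climb v n / real n) sequentially"
    using order_tendstoD(1)[OF climb_rate(1)[OF v]] by simp
  then show "eventually (\<lambda>n. a < log_hit v n / real n) sequentially"
    by eventually_elim
       (use log_climb_le_log_hit[OF v(2)] in \<open>meson divide_right_mono less_le_trans of_nat_0_le_iff\<close>)
next
  fix b assume b: "climb_rate v < b"
  show "eventually (\<lambda>n. log_hit v n / real n < b) sequentially"
  proof (cases "v = real L")
    case True
    have "log_hit v n = log_climb v n" for n
    proof -
      have "\<lceil>v * real n\<rceil> = int L * int n"
        unfolding True by (metis ceiling_of_nat of_nat_mult)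
      then have "hit_prob n \<lceil>v * real n\<rceil> = climb_prob n \<lceil>v * real n\<rceil>"
        using hit_prob_full_speed[of n] climb_prob_le_hit_prob[of n] by (simp add: antisym)
      then show ?thesis by (simp add: log_hit_def log_climb_def)
    qed
    then show ?thesis
      using order_tendstoD(2)[OF climb_rate(1)[OF v] b] by simp
  next
    case False
    with v have vL: "v < real L" by simp
    define \<kappa> where "\<kappa> = - ln pmin"
    have \<kappa>: "0 \<le> \<kappa>" using pmin_pos pmin_le_1 by (simp add: \<kappa>_def)
    (* The last bound makes the slope of the error term in log_hit_upper at most half of the gap
       between b and the climbing rate. *)
    define \<eta> where "\<eta> = Min {1, v / real L, (b - climb_rate v) * (real L - v) / (2 * real L * (\<kappa> + 1))}"
    have pos: "0 < v / real L" "0 < (b - climb_rate v) * (real L - v) / (2 * real L * (\<kappa> + 1))"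
      using v vL b \<kappa> L by (auto intro!: divide_pos_pos mult_pos_pos)
    then have \<eta>: "0 < \<eta>" "\<eta> \<le> 1" "\<eta> \<le> v / real L"
      "\<eta> \<le> (b - climb_rate v) * (real L - v) / (2 * real L * (\<kappa> + 1))"
      unfolding \<eta>_def by auto
    have \<eta>L: "\<eta> * real L \<le> v"
      using \<eta>(3) L by (simp add: field_simps)
    have slope: "\<kappa> * (\<eta> * real L / (real L - v)) \<le> (b - climb_rate v) / 2"
    proof -
      have "\<eta> * (2 * real L * (\<kappa> + 1)) \<le> (b - climb_rate v) * (real L - v)"
        using \<eta>(4) L \<kappa> by (simp add: pos_le_divide_eq)
      moreover have "\<eta> * (2 * real L * \<kappa>) \<le> \<eta> * (2 * real L * (\<kappa> + 1))"
        using \<eta>(1) by (intro mult_left_mono) auto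
      ultimately have "2 * (\<kappa> * (\<eta> * real L)) \<le> (b - climb_rate v) * (real L - v)"
        by (simp add: algebra_simps)
      then show ?thesis
        using vL by (simp add: field_simps)
    qed
    define K where "K = nat \<lceil>2 / \<eta>\<rceil>"
    define c where "c = ln (cost K) + \<kappa> * (v * real (delay K) / (real L - v) + 1)"
    let ?u = "\<lambda>n. ln (real n) / real n + c / real n + \<kappa> * (\<eta> * real L / (real L - v)) + climb_rate v"
    have "?u \<longlonglongrightarrow> 0 + 0 + \<kappa> * (\<eta> * real L / (real L - v)) + climb_rate v"
      by (intro tendsto_add lim_ln_over_n lim_const_over_n tendsto_const)
    moreover have "x + climb_rate v < b" if "x \<le> (b - climb_rate v) / 2" for x
      using that b by (simp add: field_simps)
    from this[OF slope] have "0 + 0 + \<kappa> * (\<eta> * real L / (real L - v)) + climb_rate v < b"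
      by simp
    ultimately have "eventually (\<lambda>n. ?u n < b) sequentially"
      by (rule order_tendstoD(2))
    moreover have "eventually (\<lambda>n. 2 / \<eta> \<le> real n) sequentially"
      by real_asymp
    ultimately show ?thesis
    proof eventually_elim
      case (elim n)
      have n: "2 \<le> \<eta> * real n"
        using elim(2) \<eta>(1) by (simp add: field_simps)
      then have n0: "0 < real n"
        by (cases "n = 0") auto
      have "log_hit v n \<le> ln (real n) + ln (cost K) +
          \<kappa> * ((\<eta> * real L * real n + v * real (delay K)) / (real L - v) + 1) + climb_rate v * real n"
        unfolding K_def \<kappa>_def by (rule log_hit_upper[OF v(1) vL \<eta>(1,2) \<eta>L n])
      also have "\<dots> = ?u n * real n"
      proof -
        define e where "e = \<eta> * real L / (real L - v)"
        define f where "f = v * real (delay K) / (real L - v)"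
        have "(\<eta> * real L * real n + v * real (delay K)) / (real L - v) = e * real n + f"
          by (simp add: e_def f_def add_divide_distrib)
        then show ?thesis
          unfolding c_def e_def[symmetric] f_def[symmetric] using n0 by (simp add: field_simps)
      qed
      finally have "log_hit v n / real n \<le> ?u n"
        by (simp only: pos_divide_le_eq[OF n0])
      with elim(1) show ?case by linarith
    qed
  qed
qed

lemma tail_prob_pos:
  assumes "0 \<le> v" "v \<le> real L"
  shows "0 < tail_prob L M \<mu> (v * real n) n"
proof -
  have "0 < pmin * hit_prob n \<lceil>v * real n\<rceil>"
    using hit_prob_pos[OF assms(2)] pmin_pos by simp
  also have "\<dots> \<le> tail_prob L M \<mu> (v * real n) n"
    using assms by (intro tail_prob_ge) simp
  finally show ?thesis .
qed

lemma rate_eqI: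
  assumes v: "0 \<le> v" "v \<le> real L" and l: "(\<lambda>n. ln (tail_prob L M \<mu> (v * real n) n) / real n) \<longlonglongrightarrow> l"
  shows "rate L M \<mu> v = ereal l"
proof -
  have "ereal (1 / real n) * log_ereal (tail_prob L M \<mu> (v * real n) n) =
      ereal (ln (tail_prob L M \<mu> (v * real n) n) / real n)" for n
    using tail_prob_pos[OF v, of n] by (simp add: log_ereal_def)
  then show ?thesis
    unfolding rate_def using l by (intro limI) simp
qed

lemma tail_prob_bounds:
  assumes "0 \<le> v" "v \<le> real L"
  shows "ln pmin + log_hit v n \<le> ln (tail_prob L M \<mu> (v * real n) n)"
    and "ln (tail_prob L M \<mu> (v * real n) n) \<le> log_hit v n"
proof -
  have "ln (pmin * hit_prob n \<lceil>v * real n\<rceil>) \<le> ln (tail_prob L M \<mu> (v * real n) n)"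
    using assms tail_prob_pos[OF assms] hit_prob_pos[OF assms(2)] pmin_pos
    by (intro ln_mono tail_prob_ge) auto
  then show "ln pmin + log_hit v n \<le> ln (tail_prob L M \<mu> (v * real n) n)"
    using hit_prob_pos[OF assms(2), of n] pmin_pos by (simp add: log_hit_def ln_mult)
  show "ln (tail_prob L M \<mu> (v * real n) n) \<le> log_hit v n"
    unfolding log_hit_def using tail_prob_pos[OF assms] hit_prob_pos[OF assms(2)]
    by (intro ln_mono tail_prob_le) auto
qed

lemma rate_eq_gam:
  assumes v: "0 < v" "v \<le> real L"
  shows "rate L M \<mu> v = ereal (climb_rate v)"
proof (rule rate_eqI)
  have "(\<lambda>n. ln pmin / real n + log_hit v n / real n) \<longlonglongrightarrow> 0 + climb_rate v"
    by (intro tendsto_add lim_const_over_n log_hit_limit v)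
  then have lower: "(\<lambda>n. ln pmin / real n + log_hit v n / real n) \<longlonglongrightarrow> climb_rate v" by simp
  show "(\<lambda>n. ln (tail_prob L M \<mu> (v * real n) n) / real n) \<longlonglongrightarrow> climb_rate v"
  proof (rule tendsto_sandwich[OF _ _ lower log_hit_limit[OF v]]; intro always_eventually allI)
    fix n
    show "ln pmin / real n + log_hit v n / real n \<le> ln (tail_prob L M \<mu> (v * real n) n) / real n"
      using tail_prob_bounds(1)[of v n] v by (simp add: add_divide_distrib[symmetric] divide_right_mono)
    show "ln (tail_prob L M \<mu> (v * real n) n) / real n \<le> log_hit v n / real n"
      using tail_prob_bounds(2)[of v n] v by (simp add: divide_right_mono)
  qed
qed (use v in auto)

lemma rate_0: "rate L M \<mu> 0 = 0"
proof -
  have hit_prob: "hit_prob n 0 = 1" for n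
  proof -
    have "hit_prob n 0 = Pr (\<lambda>_. True)"
      unfolding hit_prob_def by (rule Pr_cong) (auto simp: hits_def intro!: exI[of _ 0])
    then show ?thesis by (simp add: Pr_True)
  qed
  have "(\<lambda>n. ln (tail_prob L M \<mu> (0 * real n) n) / real n) \<longlonglongrightarrow> 0"
  proof (rule tendsto_sandwich[OF _ _ lim_const_over_n[of "ln pmin"] tendsto_const];
      intro always_eventually allI)
    fix n
    show "ln pmin / real n \<le> ln (tail_prob L M \<mu> (0 * real n) n) / real n"
      using tail_prob_bounds(1)[of 0 n] hit_prob by (intro divide_right_mono) (simp_all add: log_hit_def)
    show "ln (tail_prob L M \<mu> (0 * real n) n) / real n \<le> 0"
      using tail_prob_bounds(2)[of 0 n] hit_prob by (intro divide_nonpos_nonneg) (simp_all add: log_hit_def)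
  qed
  from rate_eqI[OF _ _ this] show ?thesis by (simp add: zero_ereal_def)
qed

lemma rate_beyond:
  assumes "real L < v"
  shows "rate L M \<mu> v = -\<infinity>"
proof -
  have "ereal (1 / real n) * log_ereal (tail_prob L M \<mu> (v * real n) n) = -\<infinity>" if "n \<ge> 1" for n
  proof -
    have "real L * real n < v * real n"
      using assms that by (intro mult_strict_right_mono) auto
    then have "int L * int n < \<lceil>v * real n\<rceil>"
      by (simp add: less_ceiling_iff)
    then have "tail_prob L M \<mu> (v * real n) n = 0"
      using hit_prob_eq_0[of n] tail_prob_le[of "v * real n" n] by (simp add: tail_prob_def antisym)
    then show ?thesis using that by (simp add: log_ereal_def)
  qed
  then have "eventually (\<lambda>n. ereal (1 / real n) * log_ereal (tail_prob L M \<mu> (v * real n) n) = -\<infinity>) sequentially"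
    unfolding eventually_sequentially by blast
  then show ?thesis
    unfolding rate_def by (intro limI tendsto_eventually)
qed

text \<open>
  A walk that gets to \<open>v n\<close> has avoided a trap about \<open>v n / L\<close> times.
\<close>

lemma climb_rate_neg:
  assumes v: "0 < v" "v \<le> real L"
  shows "climb_rate v < 0"
proof -
  have "log_hit v n / real n \<le> pmin / real n - pmin * v / real L" if "n \<ge> 1" for n
  proof -
    define k where "k = nat \<lfloor>v * real n / real L\<rfloor>"
    have k0: "0 \<le> v * real n / real L" using v by simp
    have k: "real k \<le> v * real n / real L" "v * real n / real L - 1 \<le> real k"
      unfolding k_def using k0 by linarith+
    have "real k * real L \<le> v * real n"
      using k(1) L by (simp add: field_simps)
    then have "int k * int L \<le> \<lceil>v * real n\<rceil>"
      by (simp add: le_ceiling_iff)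
    then have "hit_prob n \<lceil>v * real n\<rceil> \<le> hit_prob n (int k * int L)"
      unfolding hit_prob_def by (intro Pr_mono[OF pred_hits]) (meson hits_def order_trans)
    also have "\<dots> \<le> (1 - pmin) ^ k"
      by (rule hit_prob_decay)
    also have "\<dots> \<le> exp (- pmin) ^ k"
      using pmin_le_1 exp_ge_add_one_self[of "- pmin"] by (intro power_mono) auto
    also have "\<dots> = exp (- pmin * real k)"
      by (simp add: exp_of_nat_mult[symmetric] mult.commute)
    finally have "ln (hit_prob n \<lceil>v * real n\<rceil>) \<le> ln (exp (- pmin * real k))"
      using hit_prob_pos[OF v(2), of n] by (intro ln_mono) auto
    then have "log_hit v n \<le> - pmin * real k"
      by (simp add: log_hit_def)
    also have "\<dots> \<le> - pmin * (v * real n / real L - 1)"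
      using k(2) pmin_pos by (intro mult_left_mono_neg) auto
    finally show ?thesis
      using that L by (simp add: field_simps)
  qed
  moreover have "(\<lambda>n. pmin / real n - pmin * v / real L) \<longlonglongrightarrow> 0 - pmin * v / real L"
    by (intro tendsto_diff lim_const_over_n tendsto_const)
  ultimately have "climb_rate v \<le> 0 - pmin * v / real L"
    using log_hit_limit[OF v] by (intro LIMSEQ_le) auto
  moreover have "0 < pmin * v / real L"
    using pmin_pos v L by simp
  ultimately show ?thesis by simp
qed

text \<open>
  Split \<open>n\<close> steps into \<open>\<lceil>\<alpha> n\<rceil>\<close> steps at speed \<open>u\<close> and the remaining ones at speed \<open>v\<close>.  Rounding up in
  favour of the larger speed guarantees that the distance covered is at least \<open>(\<alpha> u + \<beta> v) n\<close>.
\<close>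

lemma climb_rate_concave_ordered:
  assumes ab: "0 < \<alpha>" "0 < \<beta>" "\<alpha> + \<beta> = 1"
    and uv: "0 < v" "v \<le> u" "u \<le> real L"
  shows "\<alpha> * climb_rate u + \<beta> * climb_rate v \<le> climb_rate (\<alpha> * u + \<beta> * v)"
proof -
  define w where "w = \<alpha> * u + \<beta> * v"
  define a where "a n = nat \<lceil>\<alpha> * real n\<rceil>" for n :: nat
  define b where "b n = n - a n" for n
  have \<beta>: "\<beta> = 1 - \<alpha>" using ab(3) by simp
  have w: "0 < w" "w \<le> real L"
  proof -
    show "0 < w" unfolding w_def using ab uv by (intro add_pos_pos mult_pos_pos) auto
    have "w \<le> \<alpha> * real L + \<beta> * real L"
      unfolding w_def using ab uv by (intro add_mono mult_left_mono) auto
    then show "w \<le> real L" using ab(3) by (simp add: distrib_right[symmetric])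
  qed
  have a: "\<alpha> * real n \<le> real (a n)" "real (a n) \<le> \<alpha> * real n + 1" "a n \<le> n" for n
  proof -
    have 0: "0 \<le> \<alpha> * real n" using ab by simp
    show "\<alpha> * real n \<le> real (a n)" "real (a n) \<le> \<alpha> * real n + 1"
      unfolding a_def using 0 by linarith+
    have "\<alpha> * real n \<le> 1 * real n" using ab by (intro mult_right_mono) auto
    then show "a n \<le> n" unfolding a_def by (simp add: nat_le_iff ceiling_le_iff)
  qed
  have b: "real (b n) = real n - real (a n)" for n
    using a(3)[of n] by (simp add: b_def of_nat_diff)
  have lim_a: "(\<lambda>n. real (a n) / real n) \<longlonglongrightarrow> \<alpha>"
  proof (rule tendsto_sandwich[of "\<lambda>_. \<alpha>" _ _ "\<lambda>n. \<alpha> + 1 / real n"])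
    show "eventually (\<lambda>n. \<alpha> \<le> real (a n) / real n) sequentially"
      using eventually_gt_at_top[of 0] by eventually_elim (use a(1) in \<open>simp add: field_simps\<close>)
    show "eventually (\<lambda>n. real (a n) / real n \<le> \<alpha> + 1 / real n) sequentially"
      using eventually_gt_at_top[of 0] by eventually_elim (use a(2) in \<open>simp add: field_simps\<close>)
    show "(\<lambda>n. \<alpha> + 1 / real n) \<longlonglongrightarrow> \<alpha>"
      using tendsto_add[OF tendsto_const[of \<alpha>] lim_const_over_n[of 1]] by simp
  qed simp
  have lim_b: "(\<lambda>n. real (b n) / real n) \<longlonglongrightarrow> \<beta>"
  proof -
    have "(\<lambda>n. 1 - real (a n) / real n) \<longlonglongrightarrow> 1 - \<alpha>"
      by (intro tendsto_intros lim_a)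
    moreover have "eventually (\<lambda>n. 1 - real (a n) / real n = real (b n) / real n) sequentially"
      using eventually_gt_at_top[of 0] by eventually_elim (simp add: b field_simps)
    ultimately show ?thesis unfolding \<beta> by (rule Lim_transform_eventually)
  qed
  have top_a: "filterlim a at_top sequentially"
  proof -
    have "filterlim (\<lambda>n. \<alpha> * real n) at_top sequentially"
      using ab(1) by real_asymp
    then have "filterlim (\<lambda>n. real (a n)) at_top sequentially"
      by (rule filterlim_at_top_mono) (use a(1) in auto)
    then show ?thesis by (simp add: filterlim_sequentially_iff_filterlim_real)
  qed
  have top_b: "filterlim b at_top sequentially"
  proof -
    have "filterlim (\<lambda>n. \<beta> * real n - 1) at_top sequentially"
      using ab(2) by real_asymp
    then have "filterlim (\<lambda>n. real (b n)) at_top sequentially"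
      by (rule filterlim_at_top_mono) (use a(2) in \<open>auto simp: b \<beta> algebra_simps\<close>)
    then show ?thesis by (simp add: filterlim_sequentially_iff_filterlim_real)
  qed
  have part: "(\<lambda>n. log_climb r (k n) / real n) \<longlonglongrightarrow> p * climb_rate r"
    if "0 < r" "r \<le> real L" "filterlim k at_top sequentially" "(\<lambda>n. real (k n) / real n) \<longlonglongrightarrow> p"
    for r p and k :: "nat \<Rightarrow> nat"
  proof -
    have "(\<lambda>n. log_climb r (k n) / real (k n)) \<longlonglongrightarrow> climb_rate r"
      by (rule filterlim_compose[OF climb_rate(1)[OF that(1,2)] that(3)])
    with that(4) have "(\<lambda>n. real (k n) / real n * (log_climb r (k n) / real (k n))) \<longlonglongrightarrow> p * climb_rate r"
      by (rule tendsto_mult)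
    moreover have "eventually (\<lambda>n. 1 \<le> k n) sequentially"
      using that(3) unfolding filterlim_at_top by blast
    then have "eventually (\<lambda>n. real (k n) / real n * (log_climb r (k n) / real (k n)) = log_climb r (k n) / real n) sequentially"
      by eventually_elim simp
    ultimately show ?thesis by (rule Lim_transform_eventually)
  qed
  have "(\<lambda>n. log_climb u (a n) / real n + log_climb v (b n) / real n) \<longlonglongrightarrow> \<alpha> * climb_rate u + \<beta> * climb_rate v"
    using uv by (intro tendsto_add part top_a top_b lim_a lim_b) auto
  moreover have "log_climb u (a n) / real n + log_climb v (b n) / real n \<le> log_climb w n / real n" for n
  proof -
    have n: "a n + b n = n" using a(3)[of n] by (simp add: b_def)
    have "(u - v) * (\<alpha> * real n) \<le> (u - v) * real (a n)"
      using a(1) uv by (intro mult_left_mono) auto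
    then have "w * real (a n + b n) \<le> u * real (a n) + v * real (b n)"
      unfolding n by (simp add: w_def b \<beta> algebra_simps)
    then have "log_climb u (a n) + log_climb v (b n) \<le> log_climb w (a n + b n)"
      using uv by (intro log_climb_superadditive) auto
    then show ?thesis
      unfolding n by (simp add: add_divide_distrib[symmetric] divide_right_mono)
  qed
  ultimately have "\<alpha> * climb_rate u + \<beta> * climb_rate v \<le> climb_rate w"
    using climb_rate(1)[OF w] by (intro LIMSEQ_le) auto
  then show ?thesis by (simp add: w_def)
qed

lemma climb_rate_concave:
  assumes "0 < \<alpha>" "0 < \<beta>" "\<alpha> + \<beta> = 1" "0 < u" "u \<le> real L" "0 < v" "v \<le> real L"
  shows "\<alpha> * climb_rate u + \<beta> * climb_rate v \<le> climb_rate (\<alpha> * u + \<beta> * v)"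
proof (cases "v \<le> u")
  case False
  then have "\<beta> * climb_rate v + \<alpha> * climb_rate u \<le> climb_rate (\<beta> * v + \<alpha> * u)"
    using assms by (intro climb_rate_concave_ordered) auto
  then show ?thesis by (simp add: add.commute)
qed (use assms in \<open>simp add: climb_rate_concave_ordered\<close>)

lemma rate_neg:
  assumes "0 < v"
  shows "rate L M \<mu> v < 0"
  using assms rate_eq_gam[of v] climb_rate_neg[of v] rate_beyond[of v]
  by (cases "v \<le> real L") (auto simp: zero_ereal_def)

lemma rate_concave:
  assumes ab: "0 < \<alpha>" "0 < \<beta>" "\<alpha> + \<beta> = 1" and uv: "0 < u" "0 < v"
  shows "ereal \<alpha> * rate L M \<mu> u + ereal \<beta> * rate L M \<mu> v \<le> rate L M \<mu> (\<alpha> * u + \<beta> * v)"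
proof (cases "u \<le> real L \<and> v \<le> real L")
  case True
  have "0 < \<alpha> * u + \<beta> * v"
    using ab uv by (intro add_pos_pos mult_pos_pos) auto
  moreover have "\<alpha> * u + \<beta> * v \<le> \<alpha> * real L + \<beta> * real L"
    using True ab by (intro add_mono mult_left_mono) auto
  moreover have "\<alpha> * real L + \<beta> * real L = real L"
    using ab(3) by (simp add: distrib_right[symmetric])
  ultimately show ?thesis
    using True uv climb_rate_concave[OF ab] by (simp add: rate_eq_gam)
next
  case False
  have "x + y = -\<infinity>" if "x \<noteq> \<infinity>" "y \<noteq> \<infinity>" "x = -\<infinity> \<or> y = -\<infinity>" for x y :: ereal
    using that by (cases x; cases y) auto
  moreover have "ereal \<alpha> * rate L M \<mu> u \<noteq> \<infinity>" "ereal \<beta> * rate L M \<mu> v \<noteq> \<infinity>"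
    using rate_neg[OF uv(1)] rate_neg[OF uv(2)] ab by (auto simp: ereal_mult_eq_PInfty less_imp_le)
  moreover have "ereal \<alpha> * rate L M \<mu> u = -\<infinity> \<or> ereal \<beta> * rate L M \<mu> v = -\<infinity>"
    using False rate_beyond[of u] rate_beyond[of v] ab by auto
  ultimately have sum: "ereal \<alpha> * rate L M \<mu> u + ereal \<beta> * rate L M \<mu> v = -\<infinity>"
    by blast
  show ?thesis unfolding sum by simp
qed

end

theorem theorem5:
  fixes L M :: nat and \<mu> :: "int pmf"
  assumes "L \<ge> 1" and "M \<ge> 3"
    and "set_pmf \<mu> = {- int L..int L}"
  shows "(\<forall>\<alpha> \<beta> v\<^sub>1 v\<^sub>2 :: real. \<alpha> > 0 \<longrightarrow> \<beta> > 0 \<longrightarrow> \<alpha> + \<beta> = 1 \<longrightarrow> v\<^sub>1 > 0 \<longrightarrow> v\<^sub>2 > 0 \<longrightarrow>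
            rate L M \<mu> (\<alpha> * v\<^sub>1 + \<beta> * v\<^sub>2)
              \<ge> ereal \<alpha> * rate L M \<mu> v\<^sub>1 + ereal \<beta> * rate L M \<mu> v\<^sub>2)
       \<and> rate L M \<mu> 0 = 0
       \<and> (\<forall>v>0. rate L M \<mu> v < 0)
       \<and> (\<forall>v>real L. rate L M \<mu> v = -\<infinity>)"
proof -
  interpret cookie_walk L M \<mu>
    by standard (use assms in auto)
  show ?thesis
    using rate_concave rate_0 rate_neg rate_beyond by blast
qed

end
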